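(* Let $\Xi\subset\mathbb{R}$ be an open set containing $0$, let $f\in C^4(\mathbb{R})$ be a probability density function on $\mathbb{R}$, and suppose that the moment generating function $M_f(t)=\int_{\mathbb{R}}e^{tz}f(z)\,dz$ is finite for all $t\in 2\Xi=\{2\xi\mid \xi\in\Xi\}$. Let $\mathcal{S}_f$ be the location-scale-shape model generated by $f$, regarded as a 3-dimensional manifold with global coordinates $\theta=(\mu,\sigma,\xi)\in\mathbb{R}\times\mathbb{R}_{>0}\times\Xi$, and let $g_W$ be the Wasserstein metric on it. Then the Riemannian curvature of the Riemannian manifold $(\mathcal{S}_f,g_W)$ vanishes identically.
   Context: Location-scale-shape model generated by $f$: $\mathcal{S}_f=\{p(\cdot;\theta)\mid \theta=(\mu,\sigma,\xi)\in\mathbb{R}\times\mathbb{R}_{>0}\times\Xi\}$, where, for $\xi\neq 0$, $p(x;\theta)=\frac1\sigma\left(1+\xi\frac{x-\mu}{\sigma}\right)^{-1}f\left(\frac1\xi\log\left(1+\xi\frac{x-\mu}{\sigma}\right)\right)$ if $1+\xi\frac{x-\mu}{\sigma}>0$ and $p(x;\theta)=0$ otherwise; and, for $\xi=0$, $p(x;\theta)=\frac1\sigma f\left(\frac{x-\mu}{\sigma}\right)$. Wasserstein score functions: for a parametric family of densities $p(x;\theta)$ on $\mathbb{R}$, the Wasserstein score function $\Phi^W_i(x;\theta)$ of the parameter $\theta_i$ is a solution of $\frac{\partial}{\partial x}\left(p(x;\theta)\frac{\partial}{\partial x}\Phi^W_i(x;\theta)\right)=-\frac{\partial}{\partial\theta_i}p(x;\theta)$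 with $\mathbb{E}_\theta[\Phi^W_i(X;\theta)]=0$. For $\mathcal{S}_f$ the score functions used are those with (on $\{x: 1+\xi\frac{x-\mu}{\sigma}>0\}$, writing $t=1+\xi\frac{x-\mu}{\sigma}$) $\partial_x\Phi^W_\mu=1$, $\partial_x\Phi^W_\sigma=\frac{x-\mu}{\sigma}$, and $\partial_x\Phi^W_\xi=\frac{\sigma}{\xi^2}(t\log t-t+1)$ for $\xi\ne0$, $\partial_x\Phi^W_\xi=\frac{\sigma}{2}\left(\frac{x-\mu}{\sigma}\right)^2$ for $\xi=0$. Wasserstein information matrix: $I^W(\theta)_{ij}=\mathbb{E}_\theta\left[\partial_x\Phi^W_i(X;\theta)\,\partial_x\Phi^W_j(X;\theta)\right]$, where $X\sim p(\cdot;\theta)$. The Wasserstein metric $g_W$ is the Riemannian metric whose matrix in the coordinates $\theta$ is $I^W(\theta)$. *)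

theory Defs
  imports "HOL-Analysis.Analysis"
begin

section \<open>Differential geometry in global coordinates on an open subset of Euclidean space\<close>

definition pd :: "'n::finite \<Rightarrow> (real^'n \<Rightarrow> real) \<Rightarrow> real^'n \<Rightarrow> real" where
  "pd i F \<theta> = deriv (\<lambda>t. F (\<theta> + t *\<^sub>R axis i 1)) 0"

(* Meant for open U, where differentiability together with C^k partial derivatives is C^(k+1). *)
primrec Ck_on :: "nat \<Rightarrow> (real^'n::finite \<Rightarrow> real) \<Rightarrow> (real^'n) set \<Rightarrow> bool" where
  "Ck_on 0 F U \<longleftrightarrow> continuous_on U F"
| "Ck_on (Suc k) F U \<longleftrightarrow> F differentiable_on U \<and> (\<forall>i. Ck_on k (pd i F) U)"

definition riemannian_metric_on :: "(real^'n::finite) set \<Rightarrow> (real^'n \<Rightarrow> real^'n^'n) \<Rightarrow> bool" where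
  "riemannian_metric_on U g \<longleftrightarrow>
     (\<forall>i j k. Ck_on k (\<lambda>\<theta>. g \<theta> $ i $ j) U) \<and>
     (\<forall>\<theta>\<in>U. transpose (g \<theta>) = g \<theta> \<and> (\<forall>v. v \<noteq> 0 \<longrightarrow> v \<bullet> (g \<theta> *v v) > 0))"

(* christoffel g k i j is the symbol of the second kind with upper index k and lower indices i, j. *)
definition christoffel ::
    "(real^'n::finite \<Rightarrow> real^'n^'n) \<Rightarrow> 'n \<Rightarrow> 'n \<Rightarrow> 'n \<Rightarrow> real^'n \<Rightarrow> real" where
  "christoffel g k i j \<theta> = 1/2 * (\<Sum>l\<in>UNIV. matrix_inv (g \<theta>) $ k $ l *
     (pd i (\<lambda>\<theta>. g \<theta> $ j $ l) \<theta> + pd j (\<lambda>\<theta>. g \<theta> $ i $ l) \<theta> - pd l (\<lambda>\<theta>. g \<theta> $ i $ j) \<theta>))"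

(* The l-th component of R(d_i, d_j) d_k for the Levi-Civita connection, where
   R(X,Y)Z = D_X D_Y Z - D_Y D_X Z - D_[X,Y] Z and d_i are the coordinate vector fields. *)
definition riemann_curvature ::
    "(real^'n::finite \<Rightarrow> real^'n^'n) \<Rightarrow> 'n \<Rightarrow> 'n \<Rightarrow> 'n \<Rightarrow> 'n \<Rightarrow> real^'n \<Rightarrow> real" where
  "riemann_curvature g l i j k \<theta> =
     pd i (christoffel g l j k) \<theta> - pd j (christoffel g l i k) \<theta> +
     (\<Sum>m\<in>UNIV. christoffel g l i m \<theta> * christoffel g m j k \<theta>
             - christoffel g l j m \<theta> * christoffel g m i k \<theta>)"

section \<open>Wasserstein score functions and information matrix\<close>

(* Expectation of h(X) for X with density q. Values of h where q vanishes are irrelevant,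
   so h need not be measurable there. *)
definition expect :: "(real \<Rightarrow> real) \<Rightarrow> (real \<Rightarrow> real) \<Rightarrow> real" where
  "expect q h = (\<integral>x. h x * q x \<partial>lborel)"

(* \<phi> solves d/dx (p d/dx \<phi>) = - d/d\<theta>_i p on S and has mean zero; S is an open set
   outside of which the density p \<theta> vanishes. *)
definition wasserstein_score ::
    "(real^'n::finite \<Rightarrow> real \<Rightarrow> real) \<Rightarrow> real set \<Rightarrow> real^'n \<Rightarrow> 'n \<Rightarrow> (real \<Rightarrow> real) \<Rightarrow> bool" where
  "wasserstein_score p S \<theta> i \<phi> \<longleftrightarrow>
     (\<forall>x\<in>S. \<phi> differentiable (at x) \<and>
        (\<lambda>t. p (\<theta> + t *\<^sub>R axis i 1) x) differentiable (at 0) \<and>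
        ((\<lambda>x. p \<theta> x * deriv \<phi> x) has_real_derivative - pd i (\<lambda>\<theta>. p \<theta> x) \<theta>) (at x)) \<and>
     integrable lborel (\<lambda>x. \<phi> x * p \<theta> x) \<and> expect (p \<theta>) \<phi> = 0"

definition wasserstein_information ::
    "(real^'n::finite \<Rightarrow> real \<Rightarrow> real) \<Rightarrow> ('n \<Rightarrow> real^'n \<Rightarrow> real \<Rightarrow> real) \<Rightarrow> real^'n \<Rightarrow> real^'n^'n" where
  "wasserstein_information p \<Phi> \<theta> =
     (\<chi> i j. expect (p \<theta>) (\<lambda>x. deriv (\<Phi> i \<theta>) x * deriv (\<Phi> j \<theta>) x))"

section \<open>Location-scale-shape models\<close>

(* The parameter \<theta> = (\<mu>, \<sigma>, \<xi>) has components \<theta>$1, \<theta>$2, \<theta>$3. *)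
definition lss_params :: "real set \<Rightarrow> (real^3) set" where
  "lss_params \<Xi> = {\<theta>. \<theta>$2 > 0 \<and> \<theta>$3 \<in> \<Xi>}"

definition lss_t :: "real^3 \<Rightarrow> real \<Rightarrow> real" where
  "lss_t \<theta> x = 1 + \<theta>$3 * ((x - \<theta>$1) / \<theta>$2)"

definition lss_support :: "real^3 \<Rightarrow> real set" where
  "lss_support \<theta> = {x. lss_t \<theta> x > 0}"

definition lss_density :: "(real \<Rightarrow> real) \<Rightarrow> real^3 \<Rightarrow> real \<Rightarrow> real" where
  "lss_density f \<theta> x =
     (if \<theta>$3 = 0 then 1 / \<theta>$2 * f ((x - \<theta>$1) / \<theta>$2)
      else if lss_t \<theta> x > 0 then 1 / \<theta>$2 * inverse (lss_t \<theta> x) * f (1 / \<theta>$3 * ln (lss_t \<theta> x))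
      else 0)"

definition lss_score_dx :: "real^3 \<Rightarrow> 3 \<Rightarrow> real \<Rightarrow> real" where
  "lss_score_dx \<theta> i x =
     (if i = 1 then 1
      else if i = 2 then (x - \<theta>$1) / \<theta>$2
      else if \<theta>$3 = 0 then \<theta>$2 / 2 * ((x - \<theta>$1) / \<theta>$2)\<^sup>2
      else \<theta>$2 / (\<theta>$3)\<^sup>2 * (lss_t \<theta> x * ln (lss_t \<theta> x) - lss_t \<theta> x + 1))"

(* The score equation only determines p d/dx \<phi> up to an additive constant; the second conjunct
   selects the solutions that define the Wasserstein metric of the model. *)
definition lss_scores :: "(real \<Rightarrow> real) \<Rightarrow> real set \<Rightarrow> (3 \<Rightarrow> real^3 \<Rightarrow> real \<Rightarrow> real) \<Rightarrow> bool" where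
  "lss_scores f \<Xi> \<Phi> \<longleftrightarrow> (\<forall>\<theta>\<in>lss_params \<Xi>. \<forall>i.
     wasserstein_score (lss_density f) (lss_support \<theta>) \<theta> i (\<Phi> i \<theta>) \<and>
     (\<forall>x\<in>lss_support \<theta>. (\<Phi> i \<theta> has_real_derivative lss_score_dx \<theta> i x) (at x)))"

section \<open>Hypotheses on the generating density\<close>

definition Ck_real :: "nat \<Rightarrow> (real \<Rightarrow> real) \<Rightarrow> bool" where
  "Ck_real n f \<longleftrightarrow> (\<forall>k<n. (deriv ^^ k) f differentiable_on UNIV) \<and> continuous_on UNIV ((deriv ^^ n) f)"

definition prob_density :: "(real \<Rightarrow> real) \<Rightarrow> bool" where
  "prob_density f \<longleftrightarrow> (\<forall>z. f z \<ge> 0) \<and> has_bochner_integral lborel f 1"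

definition mgf :: "(real \<Rightarrow> real) \<Rightarrow> real \<Rightarrow> ennreal" where
  "mgf f t = (\<integral>\<^sup>+z. ennreal (exp (t * z) * f z) \<partial>lborel)"

end

(*
Put ibc 0 \<xi> z = (exp (\<xi> z) - 1) / \<xi>. The map z |-> \<mu> + \<sigma> * ibc 0 \<xi> z pushes f forward to p(.; \<theta>),
and along it the score derivatives become the \<theta>-derivatives 1, ibc 0, \<sigma> * ibc 1 of this map, where
ibc i is the i-th \<xi>-derivative of ibc 0. So g_W is the metric induced by the immersion
\<theta> |-> \<mu> + \<sigma> * ibc 0 \<xi> into L^2(f), whose image is the product of a line (the constants) with the
cone over a curve and hence is flat. In coordinates the Gauss formula gives the Christoffel symbols:
d_2 d_3 of the immersion is d_3 / \<sigma>, d_3 d_3 is \<sigma> * ibc 2, projected onto the span of 1, ibc 0, ibc 1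
with coefficients depending on \<xi> only, and all other second derivatives vanish.
*)

theory Submission
  imports Defs
begin

section \<open>The inverse Box--Cox transform and its parameter derivatives\<close>

text \<open>Why the cone is flat: in L^2(f) only the second derivative taken twice in \<xi> leaves
  the tangent space, so the second fundamental form has rank at most one and the Gauss equation
  leaves no curvature. The coefficients of the projected \<open>ibc 2\<close> are never computed;
  that they depend on \<xi> alone is enough. Two analytic obstacles shape the rest. The model is
  defined by cases at \<xi> = 0, and formulas with division by \<xi> would need a limit for every
  derivative. \<open>exp_moment i\<close> is the i-th derivative of (exp u - 1) / u written as an
  integral, for which 0 is an ordinary point. Secondly, M_f is finite only on 2\<Xi>, so a product
  of two functions of growth exp (\<xi> z) can be integrated against f, but no longer product.
  Differentiation in \<xi> costs only powers of z, and the openness of \<Xi> pays for these; this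
  yields smoothness of every order.\<close>

definition exp_moment :: "nat \<Rightarrow> real \<Rightarrow> real" where
  "exp_moment i u = integral {0..1} (\<lambda>s. s ^ i * exp (s * u))"

lemma exp_moment_integrable: "(\<lambda>s. s ^ i * exp (s * u)) integrable_on {0..1::real}"
  by (intro integrable_continuous_interval continuous_intros)

lemma exp_moment_nonneg: "0 \<le> exp_moment i u"
  unfolding exp_moment_def by (intro integral_nonneg exp_moment_integrable) auto

text \<open>The exponent s u lies between 0 and u, so the integrand is at most the larger of 1 and
  exp u; a sum in place of the maximum is easier to multiply out.\<close>

lemma exp_moment_le: "exp_moment i u \<le> 1 + exp u"
proof -
  have "exp_moment i u \<le> integral {0..1} (\<lambda>s::real. 1 + exp u)"
    unfolding exp_moment_def
  proof (rule integral_le[OF exp_moment_integrable])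
    fix s :: real assume s: "s \<in> {0..1}"
    have "s * u \<le> max 0 u"
      using s mult_right_mono[of s 1 u] mult_nonneg_nonpos[of s u] by (auto simp: max_def)
    then have "exp (s * u) \<le> exp (max 0 u)" by simp
    also have "\<dots> \<le> 1 + exp u" by (auto simp: max_def)
    finally have "exp (s * u) \<le> 1 + exp u" .
    then have "s ^ i * exp (s * u) \<le> 1 * (1 + exp u)"
      using s by (intro mult_mono power_le_one) auto
    then show "s ^ i * exp (s * u) \<le> 1 + exp u" by simp
  qed auto
  then show ?thesis by simp
qed

lemma exp_moment_has_derivative:
  "(exp_moment i has_real_derivative exp_moment (Suc i) u) (at u)"
proof -
  have "((\<lambda>u. integral (cbox 0 1) (\<lambda>s. s ^ i * exp (s * u))) has_real_derivative
      integral (cbox 0 1) (\<lambda>s. s ^ Suc i * exp (s * u))) (at u within UNIV)"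
    by (rule leibniz_rule_field_derivative)
       (auto intro!: derivative_eq_intros continuous_intros exp_moment_integrable
         simp: split_beta)
  then show ?thesis by (simp add: exp_moment_def[abs_def])
qed

lemma exp_moment_continuous[continuous_intros]:
  "continuous_on S g \<Longrightarrow> continuous_on S (\<lambda>x. exp_moment i (g x))"
  by (rule continuous_on_compose2[where t = UNIV])
     (auto intro: DERIV_continuous_on exp_moment_has_derivative)

lemma exp_moment_0: "u * exp_moment 0 u = exp u - 1"
proof -
  have "((\<lambda>s. u * exp (s * u)) has_integral (exp (1 * u) - exp (0 * u))) {0..1}"
    by (rule fundamental_theorem_of_calculus)
       (auto intro!: derivative_eq_intros simp flip: has_real_derivative_iff_has_vector_derivative)
  then show ?thesis by (simp add: exp_moment_def integral_unique flip: integral_mult_right)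
qed

text \<open>Integration by parts: integrate the derivative of
  \<open>s ^ Suc i * exp (s * u)\<close>, which vanishes at s = 0. Left undivided by u, the
  recurrence also holds at u = 0.\<close>

lemma exp_moment_Suc: "u * exp_moment (Suc i) u = exp u - real (Suc i) * exp_moment i u"
proof -
  have "((\<lambda>s. real (Suc i) * (s ^ i * exp (s * u)) + u * (s ^ Suc i * exp (s * u))) has_integral
      (1 ^ Suc i * exp (1 * u) - 0 ^ Suc i * exp (0 * u))) {0..1}"
  proof (rule fundamental_theorem_of_calculus[where f = "\<lambda>s. s ^ Suc i * exp (s * u)"])
    fix s :: real
    have exp: "((\<lambda>s. exp (s * u)) has_real_derivative exp (s * u) * u) (at s within {0..1})"
      by (auto intro!: derivative_eq_intros)
    have "((\<lambda>s. s ^ Suc i * exp (s * u)) has_real_derivative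
        real (Suc i) * (s ^ i * exp (s * u)) + u * (s ^ Suc i * exp (s * u))) (at s within {0..1})"
      by (rule DERIV_cong[OF DERIV_mult[OF DERIV_pow[of "Suc i"] exp]]) (simp add: mult_ac)
    then show "((\<lambda>s. s ^ Suc i * exp (s * u)) has_vector_derivative
        real (Suc i) * (s ^ i * exp (s * u)) + u * (s ^ Suc i * exp (s * u))) (at s within {0..1})"
      by (simp only: has_real_derivative_iff_has_vector_derivative)
  qed simp
  moreover have "((\<lambda>s. real (Suc i) * (s ^ i * exp (s * u)) + u * (s ^ Suc i * exp (s * u)))
      has_integral (real (Suc i) * exp_moment i u + u * exp_moment (Suc i) u)) {0..1}"
    unfolding exp_moment_def
    by (intro has_integral_add has_integral_mult_right integrable_integral exp_moment_integrable)
  ultimately have "1 ^ Suc i * exp (1 * u) - 0 ^ Suc i * exp (0 * u)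
      = real (Suc i) * exp_moment i u + u * exp_moment (Suc i) u"
    by (rule has_integral_unique)
  then show ?thesis by simp
qed

(* ibc i is the i-th derivative in \<xi> of (exp (\<xi> z) - 1) / \<xi>, continued analytically to \<xi> = 0. *)
definition ibc :: "nat \<Rightarrow> real \<Rightarrow> real \<Rightarrow> real" where
  "ibc i \<xi> z = z ^ Suc i * exp_moment i (\<xi> * z)"

lemma ibc_has_derivative_param:
  "((\<lambda>\<xi>. ibc i \<xi> z) has_real_derivative ibc (Suc i) \<xi> z) (at \<xi>)"
  unfolding ibc_def
  by (auto intro!: derivative_eq_intros DERIV_chain2[OF exp_moment_has_derivative])

lemma ibc_continuous: "continuous_on UNIV (ibc i \<xi>)"
  unfolding ibc_def by (intro continuous_intros)

lemma ibc_0_has_derivative: "(ibc 0 \<xi> has_real_derivative exp (\<xi> * z)) (at z)"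
proof -
  have "((\<lambda>z. z * exp_moment 0 (\<xi> * z)) has_real_derivative
      exp_moment 0 (\<xi> * z) + \<xi> * z * exp_moment 1 (\<xi> * z)) (at z)"
    by (auto intro!: derivative_eq_intros DERIV_chain2[OF exp_moment_has_derivative])
  then show ?thesis
    using exp_moment_Suc[of "\<xi> * z" 0] by (simp add: ibc_def[abs_def])
qed

text \<open>The z-derivative of \<open>ibc 0\<close> is exp (\<xi> z), and differentiating that in
  \<xi> gives the present one. Both have the common factor exp (\<xi> z), on which the linear
  independence of the scores will rest.\<close>

lemma ibc_1_has_derivative: "(ibc (Suc 0) \<xi> has_real_derivative z * exp (\<xi> * z)) (at z)"
proof -
  have "((\<lambda>z. z ^ 2 * exp_moment 1 (\<xi> * z)) has_real_derivative
      z * (2 * exp_moment 1 (\<xi> * z) + \<xi> * z * exp_moment 2 (\<xi> * z))) (at z)"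
    by (auto intro!: derivative_eq_intros DERIV_chain2[OF exp_moment_has_derivative]
      simp: power2_eq_square algebra_simps numeral_2_eq_2)
  moreover have "2 * exp_moment 1 (\<xi> * z) + \<xi> * z * exp_moment 2 (\<xi> * z) = exp (\<xi> * z)"
    using exp_moment_Suc[of "\<xi> * z" 1] by (simp add: numeral_2_eq_2)
  ultimately show ?thesis by (simp add: ibc_def[abs_def] numeral_2_eq_2)
qed

lemma ibc_0_eq: "\<xi> * ibc 0 \<xi> z = exp (\<xi> * z) - 1"
  using exp_moment_0[of "\<xi> * z"] by (simp add: ibc_def mult.assoc)

text \<open>With t = exp (\<xi> z) the right side is t ln t - t + 1, as in the prescribed shape
  score.\<close>

lemma ibc_1_eq: "\<xi>\<^sup>2 * ibc (Suc 0) \<xi> z = exp (\<xi> * z) * (\<xi> * z) - exp (\<xi> * z) + 1"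
proof -
  have "\<xi>\<^sup>2 * ibc (Suc 0) \<xi> z = (\<xi> * z) * (\<xi> * z * exp_moment (Suc 0) (\<xi> * z))"
    by (simp add: ibc_def power2_eq_square)
  also have "\<dots> = (\<xi> * z) * exp (\<xi> * z) - (\<xi> * z) * exp_moment 0 (\<xi> * z)"
    by (simp add: exp_moment_Suc algebra_simps)
  finally show ?thesis by (simp add: exp_moment_0 algebra_simps)
qed

lemma ibc_at_0: "ibc 0 0 z = z" "ibc (Suc 0) 0 z = z\<^sup>2 / 2"
  \<comment> \<open>At u = 0 the left side of the recurrence vanishes, so it evaluates
    \<open>exp_moment i 0\<close> as 1 / (i + 1).\<close>
  using exp_moment_Suc[of 0 0] exp_moment_Suc[of 0 1]
  by (auto simp: ibc_def power2_eq_square)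

lemma ibc_bound: "\<bar>ibc i \<xi> z\<bar> \<le> (1 + \<bar>z\<bar>) ^ Suc i * (1 + exp (\<xi> * z))"
  unfolding ibc_def abs_mult power_abs
  by (intro mult_mono power_mono) (use exp_moment_nonneg exp_moment_le in auto)

section \<open>Kernels with finite moments\<close>

text \<open>The constants are present for the location score 1 and its \<xi>-derivative 0. All
  members grow at most like a polynomial in z times 1 + exp (\<xi> z).\<close>

inductive_set factors :: "(real \<Rightarrow> real \<Rightarrow> real) set" where
  const: "(\<lambda>_ _. c) \<in> factors"
| ibc: "ibc i \<in> factors"

lemma factors_deriv:
  assumes "H \<in> factors"
  shows "\<exists>H'\<in>factors. \<forall>\<xi> z. ((\<lambda>\<xi>. H \<xi> z) has_real_derivative H' \<xi> z) (at \<xi>)"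
  using assms
proof cases
  case (const c)
  then show ?thesis by (intro bexI[of _ "\<lambda>_ _. 0"]) (auto intro: factors.intros)
next
  case (ibc i)
  then show ?thesis
    by (intro bexI[of _ "ibc (Suc i)"]) (auto intro: factors.intros ibc_has_derivative_param)
qed

lemma factors_bound:
  assumes "H \<in> factors"
  shows "\<exists>C n. C \<ge> 0 \<and> (\<forall>\<xi> z. \<bar>H \<xi> z\<bar> \<le> C * (1 + \<bar>z\<bar>) ^ n * (1 + exp (\<xi> * z)))"
  using assms
proof cases
  case (const c)
  then have "\<bar>H \<xi> z\<bar> \<le> \<bar>c\<bar> * (1 + \<bar>z\<bar>) ^ 0 * (1 + exp (\<xi> * z))" for \<xi> z
    by (simp add: algebra_simps)
  then show ?thesis by (meson abs_ge_zero)
next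
  case (ibc i)
  then have "\<bar>H \<xi> z\<bar> \<le> 1 * (1 + \<bar>z\<bar>) ^ Suc i * (1 + exp (\<xi> * z))" for \<xi> z
    using ibc_bound[of i \<xi> z] by simp
  then show ?thesis by (meson zero_le_one)
qed

lemma factors_continuous: "H \<in> factors \<Longrightarrow> continuous_on UNIV (H \<xi>)"
  by (erule factors.cases) (auto intro: ibc_continuous)

(* At most two factors: the integrability of exp (2 \<xi> z) f(z) bounds the moments of no longer products. *)
inductive_set kernels :: "(real \<Rightarrow> real \<Rightarrow> real) set" where
  mult: "a \<in> factors \<Longrightarrow> b \<in> factors \<Longrightarrow> (\<lambda>\<xi> z. a \<xi> z * b \<xi> z) \<in> kernels"
| add: "H \<in> kernels \<Longrightarrow> K \<in> kernels \<Longrightarrow> (\<lambda>\<xi> z. H \<xi> z + K \<xi> z) \<in> kernels"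

text \<open>The product rule turns a two-factor product into a sum of two such products, so repeated
  differentiation never demands a higher exponential moment.\<close>

lemma kernels_deriv:
  assumes "H \<in> kernels"
  shows "\<exists>H'\<in>kernels. \<forall>\<xi> z. ((\<lambda>\<xi>. H \<xi> z) has_real_derivative H' \<xi> z) (at \<xi>)"
  using assms
proof induction
  case (mult a b)
  obtain a' where a': "a' \<in> factors" "\<And>\<xi> z. ((\<lambda>\<xi>. a \<xi> z) has_real_derivative a' \<xi> z) (at \<xi>)"
    using factors_deriv[OF mult(1)] by blast
  obtain b' where b': "b' \<in> factors" "\<And>\<xi> z. ((\<lambda>\<xi>. b \<xi> z) has_real_derivative b' \<xi> z) (at \<xi>)"
    using factors_deriv[OF mult(2)] by blast
  show ?case
    by (rule bexI[of _ "\<lambda>\<xi> z. a' \<xi> z * b \<xi> z + a \<xi> z * b' \<xi> z"])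
       (auto intro!: kernels.intros a' b' mult derivative_eq_intros)
next
  case (add H K)
  then obtain H' K' where *: "H' \<in> kernels" "K' \<in> kernels"
    "\<And>\<xi> z. ((\<lambda>\<xi>. H \<xi> z) has_real_derivative H' \<xi> z) (at \<xi>)"
    "\<And>\<xi> z. ((\<lambda>\<xi>. K \<xi> z) has_real_derivative K' \<xi> z) (at \<xi>)"
    by blast
  show ?case
    by (rule bexI[of _ "\<lambda>\<xi> z. H' \<xi> z + K' \<xi> z"])
       (auto intro!: kernels.intros * derivative_eq_intros)
qed

lemma kernels_continuous: "H \<in> kernels \<Longrightarrow> continuous_on UNIV (H \<xi>)"
proof (induction rule: kernels.induct)
  case (mult a b)
  then show ?case by (intro continuous_intros factors_continuous)
next
  case (add H K)
  then show ?case by (intro continuous_intros)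
qed

lemma kernels_bound:
  assumes "H \<in> kernels"
  shows "\<exists>C n. C \<ge> 0 \<and> (\<forall>\<xi> z. \<bar>H \<xi> z\<bar> \<le> C * ((1 + \<bar>z\<bar>) ^ n * (1 + exp (2 * \<xi> * z))))"
  using assms
proof induction
  case (mult a b)
  obtain C m where C: "C \<ge> 0" "\<And>\<xi> z. \<bar>a \<xi> z\<bar> \<le> C * (1 + \<bar>z\<bar>) ^ m * (1 + exp (\<xi> * z))"
    using factors_bound[OF mult(1)] by blast
  obtain D n where D: "D \<ge> 0" "\<And>\<xi> z. \<bar>b \<xi> z\<bar> \<le> D * (1 + \<bar>z\<bar>) ^ n * (1 + exp (\<xi> * z))"
    using factors_bound[OF mult(2)] by blast
  have "\<bar>a \<xi> z * b \<xi> z\<bar> \<le> (2 * C * D) * ((1 + \<bar>z\<bar>) ^ (m + n) * (1 + exp (2 * \<xi> * z)))" for \<xi> z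
  proof -
    \<comment> \<open>With e = exp (\<xi> z) this leaves exp (2 \<xi> z) as the only exponential,
      which is the integrand of M_f at 2\<xi>.\<close>
    have sq: "(1 + e) * (1 + e) \<le> 2 * (1 + e * e)" for e :: real
      using zero_le_square[of "1 - e"] by (simp add: algebra_simps)
    have "\<bar>a \<xi> z * b \<xi> z\<bar> \<le>
        (C * (1 + \<bar>z\<bar>) ^ m * (1 + exp (\<xi> * z))) * (D * (1 + \<bar>z\<bar>) ^ n * (1 + exp (\<xi> * z)))"
      unfolding abs_mult using C D by (intro mult_mono) auto
    also have "\<dots> = (C * D * (1 + \<bar>z\<bar>) ^ (m + n)) * ((1 + exp (\<xi> * z)) * (1 + exp (\<xi> * z)))"
      by (simp add: power_add)
    also have "\<dots> \<le> (C * D * (1 + \<bar>z\<bar>) ^ (m + n)) * (2 * (1 + exp (\<xi> * z) * exp (\<xi> * z)))"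
      using C(1) D(1) by (intro mult_left_mono sq) auto
    also have "exp (\<xi> * z) * exp (\<xi> * z) = exp (2 * \<xi> * z)"
      by (simp flip: exp_add)
    finally show ?thesis by (simp add: algebra_simps)
  qed
  moreover have "2 * C * D \<ge> 0" using C D by simp
  ultimately show ?case by blast
next
  case (add H K)
  then obtain C D m n where C: "C \<ge> 0" "D \<ge> 0"
    "\<And>\<xi> z. \<bar>H \<xi> z\<bar> \<le> C * ((1 + \<bar>z\<bar>) ^ m * (1 + exp (2 * \<xi> * z)))"
    "\<And>\<xi> z. \<bar>K \<xi> z\<bar> \<le> D * ((1 + \<bar>z\<bar>) ^ n * (1 + exp (2 * \<xi> * z)))"
    by blast
  have "\<bar>H \<xi> z + K \<xi> z\<bar> \<le> (C + D) * ((1 + \<bar>z\<bar>) ^ (m + n) * (1 + exp (2 * \<xi> * z)))" for \<xi> z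
  proof -
    have mono: "c * ((1 + \<bar>z\<bar>) ^ k * (1 + exp (2 * \<xi> * z)))
        \<le> c * ((1 + \<bar>z\<bar>) ^ l * (1 + exp (2 * \<xi> * z)))" if "0 \<le> c" "k \<le> l" for c k l
      using that by (intro mult_left_mono mult_right_mono power_increasing) (auto intro: add_nonneg_nonneg)
    have "\<bar>H \<xi> z + K \<xi> z\<bar> \<le> \<bar>H \<xi> z\<bar> + \<bar>K \<xi> z\<bar>" by (rule abs_triangle_ineq)
    also have "\<dots> \<le> C * ((1 + \<bar>z\<bar>) ^ (m + n) * (1 + exp (2 * \<xi> * z)))
        + D * ((1 + \<bar>z\<bar>) ^ (m + n) * (1 + exp (2 * \<xi> * z)))"
      by (intro add_mono order_trans[OF C(3) mono] order_trans[OF C(4) mono] C) auto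
    finally show ?thesis by (simp only: distrib_right[of C D])
  qed
  moreover have "C + D \<ge> 0" using C by simp
  ultimately show ?case by blast
qed

section \<open>Moments of the generating density\<close>

lemma power_le_fact_exp:
  fixes x :: real
  assumes "0 \<le> x"
  shows "x ^ n \<le> fact n * exp x"
proof -
  have "(\<Sum>k\<in>{n}. x ^ k /\<^sub>R fact k) \<le> (\<Sum>k. x ^ k /\<^sub>R fact k)"
    using assms by (intro sum_le_suminf summable_exp_generic) auto
  then show ?thesis by (simp add: exp_def field_simps)
qed

text \<open>The set where g is nonzero is open, and a nonempty open set is not a null set.\<close>

lemma continuous_AE_zero:
  fixes g :: "real \<Rightarrow> real"
  assumes "continuous_on UNIV g" "AE z in lborel. g z = 0"
  shows "g z = 0"
proof -
  have op: "open {z. g z \<noteq> 0}"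
    using assms(1) by (simp add: open_Collect_neq)
  have "{z. g z \<noteq> 0} \<in> null_sets lborel"
    using assms(2) op AE_iff_null_sets[of "{z. g z \<noteq> 0}" lborel] by auto
  then have "negligible {z. g z \<noteq> 0}"
    by (simp add: negligible_iff_null_sets null_sets_completionI)
  with op open_not_negligible have "{z. g z \<noteq> 0} = {}" by blast
  then show ?thesis by blast
qed

locale shape_generator =
  fixes f :: "real \<Rightarrow> real" and \<Xi> :: "real set"
  assumes open_shapes: "open \<Xi>" and zero_shape: "0 \<in> \<Xi>"
    and f_continuous: "continuous_on UNIV f"
    and f_nonneg: "0 \<le> f z"
    and f_integral: "has_bochner_integral lborel f 1"
    and mgf_finite: "\<xi> \<in> \<Xi> \<Longrightarrow> mgf f (2 * \<xi>) < \<infinity>"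
begin

lemma f_measurable[measurable]: "f \<in> borel_measurable borel"
  using f_continuous by (rule borel_measurable_continuous_onI)

lemma integrable_exp:
  assumes "\<xi> \<in> \<Xi>"
  shows "integrable lborel (\<lambda>z. exp (2 * \<xi> * z) * f z)"
  using mgf_finite[OF assms] f_nonneg by (simp add: integrable_iff_bounded mgf_def abs_mult)

text \<open>A single majorant for all shapes near \<xi>. The power of 1 + |z| is absorbed by exp (2
  \<delta> |z|), which needs room in \<Xi> on both sides of \<xi> for the summand exp (2 \<eta> z)
  and on both sides of 0 for the summand 1.\<close>

lemma kernel_domination:
  assumes "\<xi> \<in> \<Xi>"
  obtains \<delta> w where "\<delta> > 0" "ball \<xi> \<delta> \<subseteq> \<Xi>" "integrable lborel (\<lambda>z. w z * f z)"
    "\<And>\<eta> z. \<eta> \<in> ball \<xi> \<delta> \<Longrightarrow> (1 + \<bar>z\<bar>) ^ n * (1 + exp (2 * \<eta> * z)) \<le> w z"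
proof -
  obtain e1 where e1: "e1 > 0" "cball \<xi> e1 \<subseteq> \<Xi>"
    using open_shapes assms open_contains_cball by blast
  obtain e2 where e2: "e2 > 0" "cball 0 e2 \<subseteq> \<Xi>"
    using open_shapes zero_shape open_contains_cball by blast
  \<comment> \<open>One \<delta> moves \<eta> away from \<xi>, another absorbs the polynomial: the
    shapes \<xi> \<plusminus> 2\<delta> and \<plusminus>2\<delta> must still lie in the closed
    balls, hence the half.\<close>
  define \<delta> where "\<delta> = min e1 e2 / 2"
  have \<delta>: "\<delta> > 0" using e1 e2 by (simp add: \<delta>_def)
  have sh: "\<xi> + 2 * \<delta> \<in> \<Xi>" "\<xi> - 2 * \<delta> \<in> \<Xi>"
    by (rule subsetD[OF e1(2)], use e1 e2 in \<open>auto simp: \<delta>_def dist_real_def\<close>)+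
  have s0: "2 * \<delta> \<in> \<Xi>" "- (2 * \<delta>) \<in> \<Xi>"
    by (rule subsetD[OF e2(2)], use e1 e2 in \<open>auto simp: \<delta>_def dist_real_def\<close>)+
  \<comment> \<open>Solves \<open>(2 * \<delta> * (1 + \<bar>z\<bar>)) ^ n \<le> fact n * exp (2 *
    \<delta> * (1 + \<bar>z\<bar>))\<close> for the power of 1 + |z|.\<close>
  define C where "C = fact n / (2 * \<delta>) ^ n * exp (2 * \<delta>)"
  define E where "E = (\<lambda>\<eta> z :: real. exp (2 * \<eta> * z))"
  define w where "w = (\<lambda>z. C * (E (\<xi> + 2 * \<delta>) z + E (\<xi> - 2 * \<delta>) z + E (2 * \<delta>) z + E (- (2 * \<delta>)) z))"
  have C: "C \<ge> 0" using \<delta> by (simp add: C_def)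
  have "integrable lborel (\<lambda>z. C * (E (\<xi> + 2 * \<delta>) z * f z + E (\<xi> - 2 * \<delta>) z * f z
      + E (2 * \<delta>) z * f z + E (- (2 * \<delta>)) z * f z))"
    unfolding E_def using sh s0
    by (intro integrable_mult_right Bochner_Integration.integrable_add integrable_exp)
  then have "integrable lborel (\<lambda>z. w z * f z)"
    by (simp add: w_def algebra_simps)
  moreover have "(1 + \<bar>z\<bar>) ^ n * (1 + exp (2 * \<eta> * z)) \<le> w z" if "\<eta> \<in> ball \<xi> \<delta>" for \<eta> z
  proof -
    have pw: "(1 + \<bar>z\<bar>) ^ n \<le> C * exp (2 * \<delta> * \<bar>z\<bar>)"
    proof -
      have "(2 * \<delta> * (1 + \<bar>z\<bar>)) ^ n \<le> fact n * exp (2 * \<delta> * (1 + \<bar>z\<bar>))"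
        using \<delta> by (intro power_le_fact_exp) simp
      then have "(2 * \<delta>) ^ n * (1 + \<bar>z\<bar>) ^ n \<le> fact n * (exp (2 * \<delta>) * exp (2 * \<delta> * \<bar>z\<bar>))"
        unfolding power_mult_distrib[of "2 * \<delta>"] by (simp add: distrib_left exp_add)
      then show ?thesis using \<delta> by (simp add: C_def pos_le_divide_eq mult.commute mult.assoc)
    qed
    have le: "exp (2 * \<delta> * \<bar>z\<bar>) * exp (2 * \<zeta> * z) \<le> E (\<zeta>' + 2 * \<delta>) z + E (\<zeta>' - 2 * \<delta>) z"
      if "\<bar>\<zeta> - \<zeta>'\<bar> \<le> \<delta>" for \<zeta> \<zeta>'
    proof -
      have "(\<zeta> - \<zeta>') * z \<le> \<delta> * \<bar>z\<bar>"
        using mult_right_mono[OF that, of "\<bar>z\<bar>"] abs_ge_self[of "(\<zeta> - \<zeta>') * z"]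
        by (simp add: abs_mult)
      then have "2 * \<delta> * \<bar>z\<bar> + 2 * \<zeta> * z \<le> 4 * \<delta> * \<bar>z\<bar> + 2 * \<zeta>' * z"
        by (simp add: algebra_simps)
      also have "\<dots> \<le> max (2 * (\<zeta>' + 2 * \<delta>) * z) (2 * (\<zeta>' - 2 * \<delta>) * z)"
        by (cases "z \<ge> 0") (auto simp: algebra_simps)
      finally have "exp (2 * \<delta> * \<bar>z\<bar> + 2 * \<zeta> * z)
          \<le> exp (max (2 * (\<zeta>' + 2 * \<delta>) * z) (2 * (\<zeta>' - 2 * \<delta>) * z))" by simp
      also have "\<dots> \<le> E (\<zeta>' + 2 * \<delta>) z + E (\<zeta>' - 2 * \<delta>) z"
        by (auto simp: E_def max_def add_increasing add_increasing2)
      finally show ?thesis by (simp add: exp_add)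
    qed
    have "(1 + \<bar>z\<bar>) ^ n * (1 + exp (2 * \<eta> * z)) \<le> C * exp (2 * \<delta> * \<bar>z\<bar>) * (1 + exp (2 * \<eta> * z))"
      by (intro mult_right_mono pw) (auto intro: add_nonneg_nonneg)
    \<comment> \<open>The summand 1 becomes exp (2 * 0 * z), so that \<open>le\<close> also applies
      to it, around shape 0.\<close>
    also have "\<dots> = C * (exp (2 * \<delta> * \<bar>z\<bar>) * exp (2 * \<eta> * z) + exp (2 * \<delta> * \<bar>z\<bar>) * exp (2 * 0 * z))"
      by (simp add: algebra_simps)
    also have "\<dots> \<le> C * ((E (\<xi> + 2 * \<delta>) z + E (\<xi> - 2 * \<delta>) z) + (E (0 + 2 * \<delta>) z + E (0 - 2 * \<delta>) z))"
      using that \<delta> by (intro mult_left_mono add_mono le C) (auto simp: dist_real_def)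
    finally show ?thesis by (simp add: w_def add.assoc)
  qed
  moreover have "ball \<xi> \<delta> \<subseteq> \<Xi>"
    using e1 e2 by (intro subset_trans[OF _ e1(2)]) (auto simp: \<delta>_def)
  ultimately show thesis using that \<delta> by blast
qed

definition moment :: "(real \<Rightarrow> real \<Rightarrow> real) \<Rightarrow> real \<Rightarrow> real" where
  "moment H \<xi> = (\<integral>z. H \<xi> z * f z \<partial>lborel)"

lemma kernels_measurable: "H \<in> kernels \<Longrightarrow> H \<xi> \<in> borel_measurable borel"
  by (intro borel_measurable_continuous_onI kernels_continuous)

lemma moment_integrable:
  assumes "H \<in> kernels" "\<xi> \<in> \<Xi>"
  shows "integrable lborel (\<lambda>z. H \<xi> z * f z)"
proof -
  obtain C n where C: "C \<ge> 0" "\<And>\<xi> z. \<bar>H \<xi> z\<bar> \<le> C * ((1 + \<bar>z\<bar>) ^ n * (1 + exp (2 * \<xi> * z)))"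
    using kernels_bound[OF assms(1)] by blast
  obtain \<delta> w where w: "\<delta> > 0" "integrable lborel (\<lambda>z. w z * f z)"
    "\<And>\<eta> z. \<eta> \<in> ball \<xi> \<delta> \<Longrightarrow> (1 + \<bar>z\<bar>) ^ n * (1 + exp (2 * \<eta> * z)) \<le> w z"
    using kernel_domination[OF assms(2)] by metis
  note kernels_measurable[OF assms(1), measurable]
  show ?thesis
  proof (rule Bochner_Integration.integrable_bound[OF integrable_mult_right[OF w(2), of C]])
    have "\<bar>H \<xi> z\<bar> \<le> C * w z" for z
      using C(2)[of \<xi> z] mult_left_mono[OF w(3)[of \<xi> z] C(1)] w(1) by simp
    then have "norm (H \<xi> z * f z) \<le> C * (w z * f z)" for z
      using mult_right_mono[OF _ f_nonneg] f_nonneg by (simp add: abs_mult mult.assoc[symmetric])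
    then show "AE z in lborel. norm (H \<xi> z * f z) \<le> norm (C * (w z * f z))"
      by (intro AE_I2) (metis abs_ge_self order_trans real_norm_def)
  qed measurable
qed

text \<open>Differentiation under the integral. The mean value inequality bounds the difference
  quotients of H by the majorant of H' on a ball, and dominated convergence applies along every
  sequence tending to \<xi>.\<close>

lemma moment_has_derivative:
  assumes H: "H \<in> kernels" and H': "H' \<in> kernels"
    and deriv: "\<And>\<xi> z. ((\<lambda>\<xi>. H \<xi> z) has_real_derivative H' \<xi> z) (at \<xi>)"
    and \<xi>: "\<xi> \<in> \<Xi>"
  shows "(moment H has_real_derivative moment H' \<xi>) (at \<xi>)"
proof -
  obtain C n where C: "C \<ge> 0" "\<And>\<xi> z. \<bar>H' \<xi> z\<bar> \<le> C * ((1 + \<bar>z\<bar>) ^ n * (1 + exp (2 * \<xi> * z)))"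
    using kernels_bound[OF H'] by blast
  obtain \<delta> w where w: "\<delta> > 0" "ball \<xi> \<delta> \<subseteq> \<Xi>" "integrable lborel (\<lambda>z. w z * f z)"
    "\<And>\<eta> z. \<eta> \<in> ball \<xi> \<delta> \<Longrightarrow> (1 + \<bar>z\<bar>) ^ n * (1 + exp (2 * \<eta> * z)) \<le> w z"
    using kernel_domination[OF \<xi>] by metis
  note kernels_measurable[OF H, measurable] kernels_measurable[OF H', measurable]
  have bound: "\<bar>H \<eta> z - H \<xi> z\<bar> \<le> C * w z * \<bar>\<eta> - \<xi>\<bar>" if "\<eta> \<in> ball \<xi> \<delta>" for \<eta> z
  proof -
    have "norm (H \<eta> z - H \<xi> z) \<le> C * w z * norm (\<eta> - \<xi>)"
    proof (rule field_differentiable_bound[of "ball \<xi> \<delta>" _ "\<lambda>\<xi>. H' \<xi> z"])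
      fix \<zeta> assume "\<zeta> \<in> ball \<xi> \<delta>"
      then show "norm (H' \<zeta> z) \<le> C * w z"
        using C(2)[of \<zeta> z] mult_left_mono[OF w(4)[of \<zeta> z] C(1)] by simp
      show "((\<lambda>\<xi>. H \<xi> z) has_real_derivative H' \<zeta> z) (at \<zeta> within ball \<xi> \<delta>)"
        by (rule has_field_derivative_at_within[OF deriv])
    qed (use that w(1) in auto)
    then show ?thesis by simp
  qed
  have "((\<lambda>\<eta>. (moment H \<eta> - moment H \<xi>) / (\<eta> - \<xi>)) \<longlongrightarrow> moment H' \<xi>) (at \<xi> within ball \<xi> \<delta>)"
    unfolding tendsto_at_iff_sequentially comp_def
  proof (intro allI impI)
    fix X assume X: "\<forall>i. X i \<in> ball \<xi> \<delta> - {\<xi>}" "X \<longlonglongrightarrow> \<xi>"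
    have X': "X i \<in> ball \<xi> \<delta>" "X i \<noteq> \<xi>" for i using X(1) by blast+
    have at: "filterlim X (at \<xi>) sequentially"
      using X(2) X'(2) by (simp add: filterlim_at)
    have lim: "(\<lambda>i. \<integral>z. (H (X i) z - H \<xi> z) / (X i - \<xi>) * f z \<partial>lborel) \<longlonglongrightarrow> (\<integral>z. H' \<xi> z * f z \<partial>lborel)"
    proof (rule integral_dominated_convergence[where w = "\<lambda>z. C * (w z * f z)"])
      show "AE z in lborel. (\<lambda>i. (H (X i) z - H \<xi> z) / (X i - \<xi>) * f z) \<longlonglongrightarrow> H' \<xi> z * f z"
      proof (intro AE_I2 tendsto_intros)
        fix z
        have "((\<lambda>\<eta>. (H \<eta> z - H \<xi> z) / (\<eta> - \<xi>)) \<longlongrightarrow> H' \<xi> z) (at \<xi>)"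
          using deriv[of z \<xi>] by (simp add: has_field_derivative_iff)
        from filterlim_compose[OF this at]
        show "(\<lambda>i. (H (X i) z - H \<xi> z) / (X i - \<xi>)) \<longlonglongrightarrow> H' \<xi> z" .
      qed
      show "AE z in lborel. norm ((H (X i) z - H \<xi> z) / (X i - \<xi>) * f z) \<le> C * (w z * f z)" for i
      proof (intro AE_I2)
        fix z
        have "\<bar>X i - \<xi>\<bar> > 0" using X'(2)[of i] by simp
        then have "\<bar>(H (X i) z - H \<xi> z) / (X i - \<xi>)\<bar> \<le> C * w z"
          using bound[OF X'(1)[of i], of z] by (simp only: abs_divide pos_divide_le_eq)
        from mult_right_mono[OF this f_nonneg[of z]]
        show "norm ((H (X i) z - H \<xi> z) / (X i - \<xi>) * f z) \<le> C * (w z * f z)"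
          using f_nonneg[of z] by (simp only: real_norm_def abs_mult mult.assoc abs_of_nonneg)
      qed
      show "integrable lborel (\<lambda>z. C * (w z * f z))"
        by (intro integrable_mult_right w(3))
    qed measurable
    have eq: "(moment H (X i) - moment H \<xi>) / (X i - \<xi>)
        = (\<integral>z. (H (X i) z - H \<xi> z) / (X i - \<xi>) * f z \<partial>lborel)" for i
    proof -
      have "X i \<in> \<Xi>" using X'(1) w(2) by blast
      have "(\<integral>z. (H (X i) z - H \<xi> z) / (X i - \<xi>) * f z \<partial>lborel)
          = (\<integral>z. (H (X i) z * f z - H \<xi> z * f z) / (X i - \<xi>) \<partial>lborel)"
        by (simp only: left_diff_distrib times_divide_eq_left)
      also have "\<dots> = (\<integral>z. H (X i) z * f z - H \<xi> z * f z \<partial>lborel) / (X i - \<xi>)"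
        by (rule integral_divide_zero)
      also have "\<dots> = (moment H (X i) - moment H \<xi>) / (X i - \<xi>)"
        unfolding moment_def
        by (subst Bochner_Integration.integral_diff[OF moment_integrable[OF H \<open>X i \<in> \<Xi>\<close>]
            moment_integrable[OF H \<xi>]]) (rule refl)
      finally show ?thesis by (rule sym)
    qed
    show "(\<lambda>i. (moment H (X i) - moment H \<xi>) / (X i - \<xi>)) \<longlonglongrightarrow> moment H' \<xi>"
      unfolding eq moment_def[of H'] by (rule lim)
  qed
  then have "((\<lambda>\<eta>. (moment H \<eta> - moment H \<xi>) / (\<eta> - \<xi>)) \<longlongrightarrow> moment H' \<xi>) (at \<xi>)"
    using at_within_open[of \<xi> "ball \<xi> \<delta>"] w(1) by simp
  then show ?thesis by (simp add: has_field_derivative_iff)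
qed

lemma moment_add:
  assumes "H \<in> kernels" "K \<in> kernels" "\<xi> \<in> \<Xi>"
  shows "moment (\<lambda>\<xi> z. H \<xi> z + K \<xi> z) \<xi> = moment H \<xi> + moment K \<xi>"
  unfolding moment_def
  using moment_integrable[OF assms(1,3)] moment_integrable[OF assms(2,3)]
  by (simp add: distrib_right)

text \<open>Only a local conclusion is possible, since f may have zeros: r vanishes on the set where
  f is nonzero, which is open, and nonempty because f has mass 1.\<close>

lemma integral_square_zero_imp:
  assumes r: "continuous_on UNIV r" and int: "integrable lborel (\<lambda>z. (r z)\<^sup>2 * f z)"
    and zero: "(\<integral>z. (r z)\<^sup>2 * f z \<partial>lborel) = 0"
  obtains S where "open S" "S \<noteq> {}" "\<And>z. z \<in> S \<Longrightarrow> r z = 0"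
proof -
  have "AE z in lborel. (r z)\<^sup>2 * f z = 0"
    using integral_nonneg_eq_0_iff_AE[OF int] zero f_nonneg by simp
  moreover have "continuous_on UNIV (\<lambda>z. (r z)\<^sup>2 * f z)"
    by (intro continuous_intros r f_continuous)
  ultimately have *: "(r z)\<^sup>2 * f z = 0" for z
    using continuous_AE_zero by blast
  have "\<exists>z. f z \<noteq> 0"
  proof (rule ccontr)
    assume "\<not> ?thesis"
    then have "f = (\<lambda>_. 0)" by auto
    then show False using has_bochner_integral_integral_eq[OF f_integral] by simp
  qed
  moreover have "open {z. f z \<noteq> 0}"
    using f_continuous by (simp add: open_Collect_neq)
  ultimately show thesis using * by (intro that[of "{z. f z \<noteq> 0}"]) auto
qed

end

section \<open>The information matrix as a Gram matrix\<close>

text \<open>The power of \<sigma> carried by the i-th score derivative after pullback along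
  \<open>quantile_map\<close>; \<open>score i\<close> is what remains, a function of \<xi> and z
  alone.\<close>

definition scale_degree :: "3 \<Rightarrow> nat" where
  "scale_degree i = (if i = 3 then 1 else 0)"

definition score :: "3 \<Rightarrow> real \<Rightarrow> real \<Rightarrow> real" where
  "score i = (if i = 1 then (\<lambda>_ _. 1) else if i = 2 then ibc 0 else ibc (Suc 0))"

lemma score_simps [simp]: "score 1 = (\<lambda>_ _. 1)" "score 2 = ibc 0" "score 3 = ibc (Suc 0)"
  by (simp_all add: score_def)

lemma scale_degree_simps [simp]:
  "scale_degree 1 = 0" "scale_degree 2 = 0" "scale_degree 3 = 1"
  by (simp_all add: scale_degree_def)

lemma score_factors: "score i \<in> factors"
  by (simp add: score_def factors.intros)

text \<open>The increasing transport of f to the model density. Composed with a quantile function of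
  f it gives one of the model, hence the name.\<close>

definition quantile_map :: "real^3 \<Rightarrow> real \<Rightarrow> real" where
  "quantile_map \<theta> z = \<theta>$1 + \<theta>$2 * ibc 0 (\<theta>$3) z"

lemma quantile_map_has_derivative:
  "(quantile_map \<theta> has_real_derivative \<theta>$2 * exp (\<theta>$3 * z)) (at z within S)"
  unfolding quantile_map_def
  by (auto intro!: derivative_eq_intros has_field_derivative_at_within[OF ibc_0_has_derivative])

lemma lss_t_quantile_map:
  "\<theta>$2 > 0 \<Longrightarrow> lss_t \<theta> (quantile_map \<theta> z) = exp (\<theta>$3 * z)"
  using ibc_0_eq[of "\<theta>$3" z] by (simp add: lss_t_def quantile_map_def)

lemma inj_quantile_map:
  assumes "\<theta>$2 > 0"
  shows "inj (quantile_map \<theta>)"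
proof (rule injI)
  fix x y assume *: "quantile_map \<theta> x = quantile_map \<theta> y"
  have "quantile_map \<theta> a < quantile_map \<theta> b" if "a < b" for a b
    using that by (rule DERIV_pos_imp_increasing)
      (use quantile_map_has_derivative assms in \<open>meson exp_gt_zero mult_pos_pos\<close>)
  with * show "x = y" by (metis less_irrefl linorder_neqE_linordered_idom)
qed

lemma range_quantile_map:
  assumes "\<theta>$2 > 0"
  shows "range (quantile_map \<theta>) = lss_support \<theta>"
proof
  show "range (quantile_map \<theta>) \<subseteq> lss_support \<theta>"
    using assms by (auto simp: lss_support_def lss_t_quantile_map)
  show "lss_support \<theta> \<subseteq> range (quantile_map \<theta>)"
  proof
    fix x assume x: "x \<in> lss_support \<theta>"
    have "\<exists>z. ibc 0 (\<theta>$3) z = (x - \<theta>$1) / \<theta>$2"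
    proof (cases "\<theta>$3 = 0")
      case True
      then show ?thesis by (auto simp: ibc_at_0)
    next
      case False
      define z where "z = ln (lss_t \<theta> x) / \<theta>$3"
      have "\<theta>$3 * ibc 0 (\<theta>$3) z = lss_t \<theta> x - 1"
        using x False by (simp add: ibc_0_eq z_def lss_support_def)
      then have "\<theta>$3 * ibc 0 (\<theta>$3) z = \<theta>$3 * ((x - \<theta>$1) / \<theta>$2)"
        by (simp add: lss_t_def)
      then have "ibc 0 (\<theta>$3) z = (x - \<theta>$1) / \<theta>$2"
        using False mult_left_cancel by blast
      then show ?thesis ..
    qed
    then obtain z where "ibc 0 (\<theta>$3) z = (x - \<theta>$1) / \<theta>$2" ..
    then have "x = quantile_map \<theta> z" using assms by (simp add: quantile_map_def)
    then show "x \<in> range (quantile_map \<theta>)" by simp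
  qed
qed

text \<open>The factor in front of the density is the derivative of \<open>quantile_map\<close>, so
  this is the pushforward of f in terms of densities.\<close>

lemma lss_density_quantile_map:
  assumes "\<theta>$2 > 0"
  shows "\<theta>$2 * exp (\<theta>$3 * z) * lss_density f \<theta> (quantile_map \<theta> z) = f z"
proof (cases "\<theta>$3 = 0")
  case True
  then show ?thesis using assms by (simp add: lss_density_def quantile_map_def ibc_at_0)
next
  case False
  then show ?thesis using assms by (simp add: lss_density_def lss_t_quantile_map)
qed

lemma lss_score_dx_quantile_map:
  assumes "\<theta>$2 > 0"
  shows "lss_score_dx \<theta> i (quantile_map \<theta> z) = \<theta>$2 ^ scale_degree i * score i (\<theta>$3) z"
proof -
  have q: "(quantile_map \<theta> z - \<theta>$1) / \<theta>$2 = ibc 0 (\<theta>$3) z"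
    using assms by (simp add: quantile_map_def)
  show ?thesis
  proof (cases "\<theta>$3 = 0")
    case True
    then show ?thesis
      using exhaust_3[of i] by (auto simp: lss_score_dx_def q ibc_at_0)
  next
    case False
    then have "ibc (Suc 0) (\<theta>$3) z
        = (exp (\<theta>$3 * z) * (\<theta>$3 * z) - exp (\<theta>$3 * z) + 1) / (\<theta>$3)\<^sup>2"
      using ibc_1_eq[of "\<theta>$3" z] by (simp add: field_simps)
    then show ?thesis
      using exhaust_3[of i] False assms
      by (auto simp: lss_score_dx_def q lss_t_quantile_map)
  qed
qed

lemma lss_density_outside: "x \<notin> lss_support \<theta> \<Longrightarrow> lss_density f \<theta> x = 0"
  by (auto simp: lss_density_def lss_support_def lss_t_def)

context shape_generator
begin

lemma lss_density_measurable: "lss_density f \<theta> \<in> borel_measurable borel"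
  unfolding lss_density_def[abs_def] lss_t_def by measurable

lemma lss_score_dx_measurable: "lss_score_dx \<theta> i \<in> borel_measurable borel"
  unfolding lss_score_dx_def[abs_def] lss_t_def by measurable

definition gram :: "(real \<Rightarrow> real \<Rightarrow> real) \<Rightarrow> (real \<Rightarrow> real \<Rightarrow> real) \<Rightarrow> real \<Rightarrow> real" where
  "gram a b = moment (\<lambda>\<xi> z. a \<xi> z * b \<xi> z)"

text \<open>Substitute x = \<open>quantile_map \<theta> z\<close>, a bijection onto the support:
  each score derivative contributes its power of \<sigma>, and the density times the Jacobian
  becomes f.\<close>

lemma integral_lss_scores:
  assumes "\<theta> \<in> lss_params \<Xi>"
  shows "(\<integral>x. lss_score_dx \<theta> i x * lss_score_dx \<theta> j x * lss_density f \<theta> x \<partial>lborel)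
    = \<theta>$2 ^ (scale_degree i + scale_degree j) * gram (score i) (score j) (\<theta>$3)"
proof -
  have pos: "\<theta>$2 > 0" and shape: "\<theta>$3 \<in> \<Xi>" using assms by (auto simp: lss_params_def)
  define G where "G = (\<lambda>x. lss_score_dx \<theta> i x * lss_score_dx \<theta> j x * lss_density f \<theta> x)"
  define H where "H = (\<lambda>z. \<theta>$2 ^ (scale_degree i + scale_degree j)
      * (score i (\<theta>$3) z * score j (\<theta>$3) z * f z))"
  note [measurable] = lss_density_measurable lss_score_dx_measurable
  have G_measurable: "G \<in> borel_measurable lborel" unfolding G_def by measurable
  have "\<bar>\<theta>$2 * exp (\<theta>$3 * z)\<bar> * G (quantile_map \<theta> z)
      = \<theta>$2 ^ (scale_degree i + scale_degree j) * (score i (\<theta>$3) z * score j (\<theta>$3) z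
        * (\<theta>$2 * exp (\<theta>$3 * z) * lss_density f \<theta> (quantile_map \<theta> z)))" for z
    using pos by (simp add: G_def lss_score_dx_quantile_map power_add)
  then have H: "(\<lambda>z. \<bar>\<theta>$2 * exp (\<theta>$3 * z)\<bar> * G (quantile_map \<theta> z)) = H"
    by (simp only: lss_density_quantile_map[OF pos] H_def)
  have H_int: "integrable lborel H"
    unfolding H_def
    using moment_integrable[OF kernels.mult[OF score_factors score_factors] shape]
    by (intro integrable_mult_right)
  \<comment> \<open>The substitution rule concerns absolute integrability for the completed measure.
    It passes from H to G on the support; since G is Borel and zero elsewhere, the result returns to
    \<open>lborel\<close>.\<close>
  have "H absolutely_integrable_on UNIV"
    using H_int by (simp add: set_integrable_def integrable_completion)
  moreover have "integral UNIV H = (\<integral>z. H z \<partial>lborel)"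
    using has_integral_integral_lborel[OF H_int] by (rule integral_unique)
  moreover note has_absolute_integral_change_of_variables_1'[of UNIV "quantile_map \<theta>"
      "\<lambda>z. \<theta>$2 * exp (\<theta>$3 * z)" G "\<integral>z. H z \<partial>lborel", unfolded H range_quantile_map[OF pos],
      OF _ quantile_map_has_derivative inj_quantile_map[OF pos]]
  ultimately have G_abs: "G absolutely_integrable_on lss_support \<theta>"
    and G_val: "integral (lss_support \<theta>) G = (\<integral>z. H z \<partial>lborel)" by auto
  have G_restrict: "(\<lambda>x. indicator (lss_support \<theta>) x *\<^sub>R G x) = G"
    "(\<lambda>x. if x \<in> lss_support \<theta> then G x else 0) = G"
    by (auto simp: G_def fun_eq_iff lss_density_outside indicator_def)
  have G_int: "integrable lborel G"
    using G_abs G_measurable unfolding set_integrable_def G_restrict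
    by (simp add: integrable_completion)
  have "(\<integral>x. G x \<partial>lborel) = integral UNIV G"
    using has_integral_integral_lborel[OF G_int] by (simp add: integral_unique)
  also have "\<dots> = integral (lss_support \<theta>) G"
    using integral_restrict_UNIV[of "lss_support \<theta>" G] by (simp only: G_restrict)
  also have "\<dots> = (\<integral>z. H z \<partial>lborel)" by (rule G_val)
  also have "\<dots> = \<theta>$2 ^ (scale_degree i + scale_degree j) * gram (score i) (score j) (\<theta>$3)"
    unfolding H_def gram_def moment_def by (rule integral_mult_right_zero)
  finally show ?thesis by (simp only: G_def)
qed

definition gram_metric :: "real^3 \<Rightarrow> real^3^3" where
  "gram_metric \<theta> = (\<chi> i j. \<theta>$2 ^ (scale_degree i + scale_degree j) * gram (score i) (score j) (\<theta>$3))"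

text \<open>Off the support nothing is known about \<open>deriv (\<Phi> i \<theta>)\<close>, but
  there the density is 0, so the integrands agree at every point.\<close>

lemma wasserstein_information_eq:
  assumes "lss_scores f \<Xi> \<Phi>" "\<theta> \<in> lss_params \<Xi>"
  shows "wasserstein_information (lss_density f) \<Phi> \<theta> = gram_metric \<theta>"
proof -
  have "deriv (\<Phi> i \<theta>) x * deriv (\<Phi> j \<theta>) x * lss_density f \<theta> x
      = lss_score_dx \<theta> i x * lss_score_dx \<theta> j x * lss_density f \<theta> x" for i j x
  proof (cases "x \<in> lss_support \<theta>")
    case True
    then have "deriv (\<Phi> k \<theta>) x = lss_score_dx \<theta> k x" for k
      using assms by (intro DERIV_imp_deriv) (auto simp: lss_scores_def)
    then show ?thesis by simp
  next
    case False
    then show ?thesis by (simp add: lss_density_outside)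
  qed
  then show ?thesis
    by (simp only: wasserstein_information_def expect_def gram_metric_def
      integral_lss_scores[OF assms(2)])
qed

lemma gram_sym: "gram a b = gram b a"
  by (simp add: gram_def mult.commute)

lemma gram_zero [simp]: "gram (\<lambda>_ _. 0) b \<xi> = 0" "gram b (\<lambda>_ _. 0) \<xi> = 0"
  by (simp_all add: gram_def moment_def)

text \<open>The squared function is the derivative of the immersion in direction v, so the form is
  its squared L^2(f) norm.\<close>

lemma gram_metric_quadratic_form:
  assumes "\<theta> \<in> lss_params \<Xi>"
  shows "integrable lborel (\<lambda>z. (v$1 + v$2 * ibc 0 (\<theta>$3) z + \<theta>$2 * v$3 * ibc (Suc 0) (\<theta>$3) z)\<^sup>2 * f z)"
    and "v \<bullet> (gram_metric \<theta> *v v)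
      = (\<integral>z. (v$1 + v$2 * ibc 0 (\<theta>$3) z + \<theta>$2 * v$3 * ibc (Suc 0) (\<theta>$3) z)\<^sup>2 * f z \<partial>lborel)"
proof -
  have shape: "\<theta>$3 \<in> \<Xi>" using assms by (auto simp: lss_params_def)
  define w where "w i = \<theta>$2 ^ scale_degree i * v$i" for i
  have int: "integrable lborel (\<lambda>z. w i * w j * (score i (\<theta>$3) z * score j (\<theta>$3) z * f z))" for i j
    using moment_integrable[OF kernels.mult[OF score_factors score_factors] shape]
    by (intro integrable_mult_right)
  have expand: "(v$1 + v$2 * ibc 0 (\<theta>$3) z + \<theta>$2 * v$3 * ibc (Suc 0) (\<theta>$3) z)\<^sup>2 * f z
      = (\<Sum>i\<in>UNIV. \<Sum>j\<in>UNIV. w i * w j * (score i (\<theta>$3) z * score j (\<theta>$3) z * f z))" for z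
    by (simp add: sum_3 w_def power2_eq_square algebra_simps)
  show "integrable lborel (\<lambda>z. (v$1 + v$2 * ibc 0 (\<theta>$3) z + \<theta>$2 * v$3 * ibc (Suc 0) (\<theta>$3) z)\<^sup>2 * f z)"
    unfolding expand by (intro Bochner_Integration.integrable_sum int)
  have "v \<bullet> (gram_metric \<theta> *v v)
      = (\<Sum>i\<in>UNIV. \<Sum>j\<in>UNIV. w i * w j * gram (score i) (score j) (\<theta>$3))"
    by (simp add: inner_vec_def matrix_vector_mult_def gram_metric_def w_def sum_distrib_left
      power_add mult_ac)
  also have "\<dots> = (\<integral>z. (\<Sum>i\<in>UNIV. \<Sum>j\<in>UNIV.
      w i * w j * (score i (\<theta>$3) z * score j (\<theta>$3) z * f z)) \<partial>lborel)"
    by (subst Bochner_Integration.integral_sum, intro Bochner_Integration.integrable_sum int,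
        subst Bochner_Integration.integral_sum, rule int)
      (simp only: gram_def moment_def integral_mult_right_zero)
  finally show "v \<bullet> (gram_metric \<theta> *v v)
      = (\<integral>z. (v$1 + v$2 * ibc 0 (\<theta>$3) z + \<theta>$2 * v$3 * ibc (Suc 0) (\<theta>$3) z)\<^sup>2 * f z \<partial>lborel)"
    by (simp only: expand)
qed

text \<open>A null vector v makes its tangent function r vanish on an open set. Differentiating in z
  and cancelling exp (\<xi> z) leaves an affine function with two zeros; so its slope, then v$2, and
  by r = 0 also v$1 vanish.\<close>

lemma gram_metric_pos:
  assumes "\<theta> \<in> lss_params \<Xi>" "v \<noteq> 0"
  shows "v \<bullet> (gram_metric \<theta> *v v) > 0"
proof (rule ccontr)
  define r where "r z = v$1 + v$2 * ibc 0 (\<theta>$3) z + \<theta>$2 * v$3 * ibc (Suc 0) (\<theta>$3) z" for z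
  note form = gram_metric_quadratic_form[OF assms(1), of v, folded r_def]
  assume "\<not> ?thesis"
  then have "(\<integral>z. (r z)\<^sup>2 * f z \<partial>lborel) \<le> 0"
    by (simp only: form(2) not_less)
  moreover have "0 \<le> (\<integral>z. (r z)\<^sup>2 * f z \<partial>lborel)"
    by (intro Bochner_Integration.integral_nonneg mult_nonneg_nonneg f_nonneg zero_le_power2)
  ultimately have zero: "(\<integral>z. (r z)\<^sup>2 * f z \<partial>lborel) = 0" by (rule antisym)
  have "continuous_on UNIV r"
    unfolding r_def by (intro continuous_intros ibc_continuous)
  then obtain S where S: "open S" "S \<noteq> {}" "\<And>z. z \<in> S \<Longrightarrow> r z = 0"
    by (rule integral_square_zero_imp[OF _ form(1) zero]) blast
  have affine: "v$2 + \<theta>$2 * v$3 * z = 0" if "z \<in> S" for z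
  proof -
    have "((\<lambda>z. v$1 + v$2 * ibc 0 (\<theta>$3) z + \<theta>$2 * v$3 * ibc (Suc 0) (\<theta>$3) z)
        has_real_derivative 0 + v$2 * exp (\<theta>$3 * z) + \<theta>$2 * v$3 * (z * exp (\<theta>$3 * z))) (at z)"
      by (intro DERIV_add DERIV_const DERIV_cmult ibc_0_has_derivative ibc_1_has_derivative)
    then have "(r has_real_derivative (v$2 + \<theta>$2 * v$3 * z) * exp (\<theta>$3 * z)) (at z)"
      unfolding r_def by (rule DERIV_cong) (simp add: distrib_right)
    moreover have "(r has_real_derivative 0) (at z)"
      by (rule has_field_derivative_transform_within_open[of "\<lambda>_. 0" 0 z S])
        (simp_all add: S(1) that S(3))
    ultimately have "(v$2 + \<theta>$2 * v$3 * z) * exp (\<theta>$3 * z) = 0"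
      by (rule DERIV_unique)
    then show ?thesis by (simp only: mult_eq_0_iff exp_not_eq_zero simp_thms)
  qed
  obtain a where a: "a \<in> S" using S(2) by blast
  with S(1) obtain e where e: "e > 0" "ball a e \<subseteq> S" by (meson openE)
  then have b: "a + e / 2 \<in> S" by (intro subsetD[OF e(2)]) (simp add: dist_real_def)
  have "\<theta>$2 * v$3 * (e / 2) = (v$2 + \<theta>$2 * v$3 * (a + e / 2)) - (v$2 + \<theta>$2 * v$3 * a)"
    by (simp add: distrib_left)
  also have "\<dots> = 0" by (simp only: affine[OF a] affine[OF b] diff_self)
  finally have "\<theta>$2 * v$3 * (e / 2) = 0" .
  then have "v$3 = 0" using e(1) assms(1) by (simp add: lss_params_def)
  moreover have "v$2 = 0" using affine[OF a] \<open>v$3 = 0\<close> by simp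
  moreover have "v$1 = 0" using S(3)[OF a] \<open>v$3 = 0\<close> \<open>v$2 = 0\<close> by (simp add: r_def)
  ultimately show False using assms(2) by (simp add: vec_eq_iff[of v 0] forall_3)
qed

end

section \<open>Locality of the geometric operations\<close>

lemma eventually_line_in_open:
  fixes \<theta> :: "real^'n::finite"
  assumes "open U" "\<theta> \<in> U"
  shows "\<forall>\<^sub>F t in nhds 0. \<theta> + t *\<^sub>R axis i 1 \<in> U"
proof -
  have "open ((\<lambda>t. \<theta> + t *\<^sub>R axis i 1) -` U)"
    by (intro continuous_open_vimage assms(1) continuous_intros)
  from eventually_nhds_in_open[OF this, of 0] show ?thesis using assms(2) by simp
qed

text \<open>The information matrix is identified only on the parameter domain, so every geometric
  operation must be seen to depend on local values alone.\<close>

lemma pd_cong: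
  assumes "open U" "\<theta> \<in> U" "\<And>\<theta>. \<theta> \<in> U \<Longrightarrow> F \<theta> = G \<theta>"
  shows "pd i F \<theta> = pd i G \<theta>"
  unfolding pd_def
  by (rule deriv_cong_ev[OF eventually_mono[OF eventually_line_in_open[OF assms(1,2)]]])
    (use assms(3) in auto)

lemma Ck_on_cong:
  assumes "open U" "\<And>\<theta>. \<theta> \<in> U \<Longrightarrow> F \<theta> = G \<theta>" "Ck_on k F U"
  shows "Ck_on k G U"
  using assms(2,3)
proof (induction k arbitrary: F G)
  case 0
  then show ?case by (simp cong: continuous_on_cong)
next
  case (Suc k)
  have "G differentiable_on U"
    unfolding differentiable_on_def
  proof
    fix \<theta> assume \<theta>: "\<theta> \<in> U"
    with Suc.prems(2) have "F differentiable (at \<theta> within U)"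
      by (simp add: differentiable_on_def)
    then show "G differentiable (at \<theta> within U)"
      by (rule differentiable_transform_within[OF _ zero_less_one \<theta>]) (simp add: Suc.prems(1))
  qed
  moreover have "Ck_on k (pd i G) U" for i
  proof (rule Suc.IH)
    show "pd i F \<theta> = pd i G \<theta>" if "\<theta> \<in> U" for \<theta>
      using assms(1) that Suc.prems(1) by (rule pd_cong)
    show "Ck_on k (pd i F) U" using Suc.prems(2) by simp
  qed
  ultimately show ?case by simp
qed

lemma christoffel_cong:
  assumes "open U" "\<theta> \<in> U" "\<And>\<theta>. \<theta> \<in> U \<Longrightarrow> g \<theta> = h \<theta>"
  shows "christoffel g k i j \<theta> = christoffel h k i j \<theta>"
proof -
  have "pd a (\<lambda>\<theta>. g \<theta> $ b $ c) \<theta> = pd a (\<lambda>\<theta>. h \<theta> $ b $ c) \<theta>" for a b c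
    using assms(3) by (intro pd_cong[OF assms(1,2)]) simp
  then show ?thesis by (simp only: christoffel_def assms(3)[OF assms(2)])
qed

section \<open>Partial derivatives in the coordinates of the model\<close>

lemma pd_1_scale_shape: "pd 1 (\<lambda>\<theta>::real^3. h (\<theta>$2) (\<theta>$3)) \<theta> = 0"
  by (simp add: pd_def axis_def)

lemma pd_2_scale_shape:
  assumes "((\<lambda>s. h s (\<theta>$3)) has_real_derivative D) (at (\<theta>$2))"
  shows "pd 2 (\<lambda>\<theta>::real^3. h (\<theta>$2) (\<theta>$3)) \<theta> = D"
proof -
  have "((\<lambda>t. h (\<theta>$2 + t) (\<theta>$3)) has_real_derivative D) (at 0)"
    using DERIV_shift[of "\<lambda>s. h s (\<theta>$3)" D 0 "\<theta>$2"] assms by (simp add: add.commute)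
  then show ?thesis by (simp add: pd_def axis_def DERIV_imp_deriv)
qed

lemma pd_3_scale_shape:
  assumes "((\<lambda>x. h (\<theta>$2) x) has_real_derivative D) (at (\<theta>$3))"
  shows "pd 3 (\<lambda>\<theta>::real^3. h (\<theta>$2) (\<theta>$3)) \<theta> = D"
proof -
  have "((\<lambda>t. h (\<theta>$2) (\<theta>$3 + t)) has_real_derivative D) (at 0)"
    using DERIV_shift[of "\<lambda>x. h (\<theta>$2) x" D 0 "\<theta>$3"] assms by (simp add: add.commute)
  then show ?thesis by (simp add: pd_def axis_def DERIV_imp_deriv)
qed

lemma open_lss_params: "open \<Xi> \<Longrightarrow> open (lss_params \<Xi>)"
proof -
  assume "open \<Xi>"
  then have "open ({\<theta>::real^3. 0 < \<theta>$2} \<inter> (\<lambda>\<theta>. \<theta>$3) -` \<Xi>)"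
    by (intro open_Int open_Collect_less continuous_open_vimage continuous_intros)
  moreover have "lss_params \<Xi> = {\<theta>. 0 < \<theta>$2} \<inter> (\<lambda>\<theta>. \<theta>$3) -` \<Xi>"
    by (auto simp: lss_params_def)
  ultimately show ?thesis by simp
qed

text \<open>Positivity forces a trivial kernel, hence invertibility; only then is the chosen
  \<open>matrix_inv A\<close> a two-sided inverse.\<close>

lemma matrix_inv_mult_vector:
  fixes A :: "real^'n^'n"
  assumes "\<And>v. v \<noteq> 0 \<Longrightarrow> v \<bullet> (A *v v) > 0"
  shows "matrix_inv A *v (A *v x) = x" and "A *v (matrix_inv A *v x) = x"
proof -
  have "A *v v = 0 \<Longrightarrow> v = 0" for v using assms[of v] by fastforce
  then have "invertible A"
    by (simp add: invertible_left_inverse matrix_left_invertible_ker)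
  then have "A ** matrix_inv A = mat 1 \<and> matrix_inv A ** A = mat 1"
    unfolding invertible_def matrix_inv_def by (rule someI_ex)
  then show "matrix_inv A *v (A *v x) = x" "A *v (matrix_inv A *v x) = x"
    by (simp_all add: matrix_vector_mul_assoc)
qed

section \<open>Curvature of the Gram metric\<close>

definition score' :: "3 \<Rightarrow> real \<Rightarrow> real \<Rightarrow> real" where
  "score' i = (if i = 1 then (\<lambda>_ _. 0) else if i = 2 then ibc (Suc 0) else ibc 2)"

lemma score'_simps [simp]:
  "score' 1 = (\<lambda>_ _. 0)" "score' 2 = ibc (Suc 0)" "score' 3 = ibc 2"
  by (simp_all add: score'_def)

lemma score'_factors: "score' i \<in> factors"
  by (simp add: score'_def factors.intros)

lemma score_has_derivative:
  "((\<lambda>\<xi>. score i \<xi> z) has_real_derivative score' i \<xi> z) (at \<xi>)"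
  using ibc_has_derivative_param[of 0 z] ibc_has_derivative_param[of "Suc 0" z]
  by (simp add: score_def score'_def numeral_2_eq_2)

context shape_generator
begin

text \<open>On the domain, all partial derivatives of c \<sigma>^n \<open>moment H\<close> have the
  same form with other c, n and H, so the induction closes once these three are arbitrary.\<close>

lemma moment_Ck:
  "H \<in> kernels \<Longrightarrow> Ck_on k (\<lambda>\<theta>. c * \<theta>$2 ^ n * moment H (\<theta>$3)) (lss_params \<Xi>)"
proof (induction k arbitrary: c n H)
  have diff: "(\<lambda>\<theta>. c * \<theta>$2 ^ n * moment H (\<theta>$3)) differentiable_on lss_params \<Xi>"
    if H: "H \<in> kernels" for c n H
    unfolding differentiable_on_def
  proof
    fix \<theta> assume "\<theta> \<in> lss_params \<Xi>"
    then have \<xi>: "\<theta>$3 \<in> \<Xi>" by (simp add: lss_params_def)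
    obtain H' where "H' \<in> kernels"
      "\<And>\<xi> z. ((\<lambda>\<xi>. H \<xi> z) has_real_derivative H' \<xi> z) (at \<xi>)"
      using kernels_deriv[OF H] by blast
    then have "moment H differentiable (at (\<theta>$3))"
      using moment_has_derivative[OF H _ _ \<xi>] real_differentiable_def by blast
    moreover have "(\<lambda>\<theta>::real^3. \<theta>$i) differentiable (at \<theta> within S)" for i S
      by (intro bounded_linear_imp_differentiable bounded_linear_vec_nth)
    ultimately have "(moment H \<circ> (\<lambda>\<theta>::real^3. \<theta>$3)) differentiable (at \<theta> within lss_params \<Xi>)"
      by (intro differentiable_chain_within) (auto intro: differentiable_at_withinI)
    then show "(\<lambda>\<theta>. c * \<theta>$2 ^ n * moment H (\<theta>$3)) differentiable (at \<theta> within lss_params \<Xi>)"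
      using \<open>\<And>S i. (\<lambda>\<theta>::real^3. \<theta>$i) differentiable (at \<theta> within S)\<close>
      by (intro differentiable_mult differentiable_power differentiable_const) (auto simp: comp_def)
  qed
  {
    case 0
    then show ?case using differentiable_imp_continuous_on[OF diff] by simp
  next
    case (Suc k)
    obtain H' where H': "H' \<in> kernels"
      "\<And>\<xi> z. ((\<lambda>\<xi>. H \<xi> z) has_real_derivative H' \<xi> z) (at \<xi>)"
      using kernels_deriv[OF Suc.prems] by blast
    let ?U = "lss_params \<Xi>" and ?F = "\<lambda>\<theta>::real^3. c * \<theta>$2 ^ n * moment H (\<theta>$3)"
    note U = open_lss_params[OF open_shapes]
    have "pd 1 ?F \<theta> = 0 * \<theta>$2 ^ n * moment H (\<theta>$3)" for \<theta>
      using pd_1_scale_shape[of "\<lambda>s x. c * s ^ n * moment H x" \<theta>] by simp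
    then have 1: "Ck_on k (pd 1 ?F) ?U"
      using Suc.IH[OF Suc.prems, of 0 n] by presburger
    \<comment> \<open>For n = 0 the truncated exponent n - 1 is harmless, as the coefficient is
      0.\<close>
    have "pd 2 ?F \<theta> = (c * real n) * \<theta>$2 ^ (n - 1) * moment H (\<theta>$3)" for \<theta>
      by (rule pd_2_scale_shape[of "\<lambda>s x. c * s ^ n * moment H x"])
        (auto intro!: derivative_eq_intros)
    then have 2: "Ck_on k (pd 2 ?F) ?U"
      using Suc.IH[OF Suc.prems, of "c * real n" "n - 1"] by presburger
    \<comment> \<open>Unlike the other two, this formula is available only for shapes in \<Xi>, so
      it is transferred by congruence on the domain.\<close>
    have "c * \<theta>$2 ^ n * moment H' (\<theta>$3) = pd 3 ?F \<theta>" if "\<theta> \<in> ?U" for \<theta>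
    proof (rule pd_3_scale_shape[of "\<lambda>s x. c * s ^ n * moment H x", symmetric])
      have "\<theta>$3 \<in> \<Xi>" using that by (simp add: lss_params_def)
      then show "((\<lambda>x. c * \<theta>$2 ^ n * moment H x) has_real_derivative c * \<theta>$2 ^ n * moment H' (\<theta>$3))
          (at (\<theta>$3))"
        by (intro DERIV_cmult moment_has_derivative Suc.prems H')
    qed
    then have 3: "Ck_on k (pd 3 ?F) ?U"
      using Suc.IH[OF H'(1), of c n] by (rule Ck_on_cong[OF U])
    show ?case using diff[OF Suc.prems] 1 2 3 by (simp add: forall_3)
  }
qed

lemma gram_metric_riemannian: "riemannian_metric_on (lss_params \<Xi>) gram_metric"
proof -
  have "Ck_on k (\<lambda>\<theta>. gram_metric \<theta> $ i $ j) (lss_params \<Xi>)" for i j k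
    using moment_Ck[OF kernels.mult[OF score_factors score_factors], of k 1 "scale_degree i + scale_degree j" i j]
    by (simp add: gram_metric_def gram_def)
  moreover have "transpose (gram_metric \<theta>) = gram_metric \<theta>" for \<theta>
    by (simp add: transpose_def gram_metric_def vec_eq_iff gram_sym add.commute)
  ultimately show ?thesis
    using gram_metric_pos by (simp add: riemannian_metric_on_def)
qed

section \<open>First derivatives of the Gram metric\<close>

lemma gram_has_derivative:
  assumes "\<xi> \<in> \<Xi>"
  shows "(gram (score i) (score j) has_real_derivative
    gram (score' i) (score j) \<xi> + gram (score i) (score' j) \<xi>) (at \<xi>)"
proof -
  have k: "(\<lambda>\<xi> z. score' i \<xi> z * score j \<xi> z) \<in> kernels"
    "(\<lambda>\<xi> z. score i \<xi> z * score' j \<xi> z) \<in> kernels"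
    "(\<lambda>\<xi> z. score i \<xi> z * score j \<xi> z) \<in> kernels"
    by (intro kernels.mult score_factors score'_factors)+
  have "(gram (score i) (score j) has_real_derivative
      moment (\<lambda>\<xi> z. score' i \<xi> z * score j \<xi> z + score i \<xi> z * score' j \<xi> z) \<xi>) (at \<xi>)"
    unfolding gram_def
    by (intro moment_has_derivative k kernels.add assms)
      (auto intro!: derivative_eq_intros score_has_derivative)
  then show ?thesis by (simp only: gram_def moment_add[OF k(1,2) assms])
qed

lemma pd_gram_metric:
  assumes "\<theta> \<in> lss_params \<Xi>"
  shows "pd 1 (\<lambda>\<theta>. gram_metric \<theta> $ i $ j) \<theta> = 0"
    and "pd 2 (\<lambda>\<theta>. gram_metric \<theta> $ i $ j) \<theta> = real (scale_degree i + scale_degree j)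
      * \<theta>$2 ^ (scale_degree i + scale_degree j - 1) * gram (score i) (score j) (\<theta>$3)"
    and "pd 3 (\<lambda>\<theta>. gram_metric \<theta> $ i $ j) \<theta> = \<theta>$2 ^ (scale_degree i + scale_degree j)
      * (gram (score' i) (score j) (\<theta>$3) + gram (score i) (score' j) (\<theta>$3))"
proof -
  have \<xi>: "\<theta>$3 \<in> \<Xi>" using assms by (simp add: lss_params_def)
  let ?h = "\<lambda>s x. s ^ (scale_degree i + scale_degree j) * gram (score i) (score j) x"
  have eq: "(\<lambda>\<theta>. gram_metric \<theta> $ i $ j) = (\<lambda>\<theta>. ?h (\<theta>$2) (\<theta>$3))"
    by (simp add: gram_metric_def)
  show "pd 1 (\<lambda>\<theta>. gram_metric \<theta> $ i $ j) \<theta> = 0"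
    unfolding eq by (rule pd_1_scale_shape)
  show "pd 2 (\<lambda>\<theta>. gram_metric \<theta> $ i $ j) \<theta> = real (scale_degree i + scale_degree j)
      * \<theta>$2 ^ (scale_degree i + scale_degree j - 1) * gram (score i) (score j) (\<theta>$3)"
    unfolding eq by (rule pd_2_scale_shape[of ?h]) (auto intro!: derivative_eq_intros)
  show "pd 3 (\<lambda>\<theta>. gram_metric \<theta> $ i $ j) \<theta> = \<theta>$2 ^ (scale_degree i + scale_degree j)
      * (gram (score' i) (score j) (\<theta>$3) + gram (score i) (score' j) (\<theta>$3))"
    unfolding eq by (intro pd_3_scale_shape[of ?h] DERIV_cmult gram_has_derivative \<xi>)
qed

(* The coefficients of the L2(f)-projection of ibc 2 onto the span of the scores. *)
definition ibc2_coeff :: "3 \<Rightarrow> real \<Rightarrow> real" where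
  "ibc2_coeff k \<xi> =
    (matrix_inv (gram_metric (vector [0, 1, \<xi>])) *v (\<chi> l. gram (ibc 2) (score l) \<xi>)) $ k"

text \<open>The normal equations of the projection. At \<sigma> = 1 the metric is the bare Gram
  matrix of the scores, so its inverse solves them.\<close>

lemma ibc2_coeff:
  assumes "\<xi> \<in> \<Xi>"
  shows "gram (score l) (score 1) \<xi> * ibc2_coeff 1 \<xi> + gram (score l) (score 2) \<xi> * ibc2_coeff 2 \<xi>
    + gram (score l) (score 3) \<xi> * ibc2_coeff 3 \<xi> = gram (ibc 2) (score l) \<xi>"
proof -
  let ?\<theta> = "vector [0, 1, \<xi>] :: real^3" and ?c = "\<chi> l. gram (ibc 2) (score l) \<xi>"
  have "?\<theta> \<in> lss_params \<Xi>" using assms by (simp add: lss_params_def)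
  then have "gram_metric ?\<theta> *v (matrix_inv (gram_metric ?\<theta>) *v ?c) = ?c"
    by (intro matrix_inv_mult_vector(2) gram_metric_pos)
  then have "(gram_metric ?\<theta> *v (\<chi> k. ibc2_coeff k \<xi>)) $ l = ?c $ l"
    by (simp only: ibc2_coeff_def vec_lambda_eta)
  then show ?thesis
    by (simp add: matrix_vector_mult_def sum_3 gram_metric_def del: score_simps)
qed

text \<open>In the tangent basis 1, \<open>ibc 0\<close>, s * \<open>ibc 1\<close>, the projection
  of s * \<open>ibc 2\<close> has coefficients s c_1, s c_2, c_3 with c = \<open>ibc2_coeff\<close>:
  the third basis vector already contains s. Likewise \<open>ibc 1\<close>, the mixed derivative, is
  1 / s times that vector.\<close>

definition lss_christoffel :: "3 \<Rightarrow> 3 \<Rightarrow> 3 \<Rightarrow> real \<Rightarrow> real \<Rightarrow> real" where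
  "lss_christoffel k i j s \<xi> =
    (if i = 3 \<and> j = 3 then (if k = 3 then 1 else s) * ibc2_coeff k \<xi>
     else if k = 3 \<and> (i = 2 \<and> j = 3 \<or> i = 3 \<and> j = 2) then 1 / s
     else 0)"

text \<open>Rather than expanding the inverse matrix, multiply the claimed symbols by the metric,
  compare with the symbols of the first kind, and invert at the end.\<close>

lemma christoffel_gram_metric:
  assumes "\<theta> \<in> lss_params \<Xi>"
  shows "christoffel gram_metric k i j \<theta> = lss_christoffel k i j (\<theta>$2) (\<theta>$3)"
proof -
  have pos: "\<theta>$2 > 0" and \<xi>: "\<theta>$3 \<in> \<Xi>" using assms by (auto simp: lss_params_def)
  have sym: "gram (\<lambda>_ _. 1) (ibc i) = gram (ibc i) (\<lambda>_ _. 1)"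
    "gram (ibc 0) (ibc (Suc 0)) = gram (ibc (Suc 0)) (ibc 0)"
    "gram (ibc 0) (ibc 2) = gram (ibc 2) (ibc 0)"
    "gram (ibc (Suc 0)) (ibc 2) = gram (ibc 2) (ibc (Suc 0))" for i
    by (rule gram_sym)+
  let ?\<Gamma> = "\<chi> k. lss_christoffel k i j (\<theta>$2) (\<theta>$3)"
  let ?c = "\<chi> l. 1/2 * (pd i (\<lambda>\<theta>. gram_metric \<theta> $ j $ l) \<theta> + pd j (\<lambda>\<theta>. gram_metric \<theta> $ i $ l) \<theta>
      - pd l (\<lambda>\<theta>. gram_metric \<theta> $ i $ j) \<theta>)"
  have lhs: "(gram_metric \<theta> *v ?\<Gamma>) $ l = \<theta>$2 ^ scale_degree l
      * (gram (score l) (score 1) (\<theta>$3) * lss_christoffel 1 i j (\<theta>$2) (\<theta>$3)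
        + gram (score l) (score 2) (\<theta>$3) * lss_christoffel 2 i j (\<theta>$2) (\<theta>$3)
        + gram (score l) (score 3) (\<theta>$3) * (\<theta>$2 * lss_christoffel 3 i j (\<theta>$2) (\<theta>$3)))" for l
    by (simp add: matrix_vector_mult_def sum_3 gram_metric_def algebra_simps del: score_simps)
  have "(gram_metric \<theta> *v ?\<Gamma>) $ l = ?c $ l" for l
  proof (cases "i = 3 \<and> j = 3")
    case True
    have "(gram_metric \<theta> *v ?\<Gamma>) $ l = \<theta>$2 ^ scale_degree l * (\<theta>$2
      * (gram (score l) (score 1) (\<theta>$3) * ibc2_coeff 1 (\<theta>$3)
        + gram (score l) (score 2) (\<theta>$3) * ibc2_coeff 2 (\<theta>$3)
        + gram (score l) (score 3) (\<theta>$3) * ibc2_coeff 3 (\<theta>$3)))"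
      unfolding lhs using True by (simp add: lss_christoffel_def algebra_simps del: score_simps)
    also have "\<dots> = \<theta>$2 ^ scale_degree l * (\<theta>$2 * gram (ibc 2) (score l) (\<theta>$3))"
      by (simp only: ibc2_coeff[OF \<xi>])
    \<comment> \<open>For l = 2 the term \<sigma> \<open>gram (ibc 1) (ibc 1)\<close> from the
      \<xi>-derivative of g_32 cancels half the \<sigma>-derivative of g_33.\<close>
    also have "\<dots> = ?c $ l"
      using exhaust_3[of l] True
      by (auto simp: pd_gram_metric[OF assms] sym power2_eq_square algebra_simps)
    finally show ?thesis .
  next
    case False
    then show ?thesis
      unfolding lhs using exhaust_3[of i] exhaust_3[of j] exhaust_3[of l] pos
      by (auto simp: lss_christoffel_def pd_gram_metric[OF assms] sym)
  qed
  then have "gram_metric \<theta> *v ?\<Gamma> = ?c" by (simp only: vec_eq_iff simp_thms)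
  moreover have "matrix_inv (gram_metric \<theta>) *v (gram_metric \<theta> *v ?\<Gamma>) = ?\<Gamma>"
    by (intro matrix_inv_mult_vector(1) gram_metric_pos assms)
  ultimately have "(matrix_inv (gram_metric \<theta>) *v ?c) $ k = ?\<Gamma> $ k" by (simp only:)
  then show ?thesis
    by (simp only: christoffel_def matrix_vector_mult_def vec_lambda_beta sum_distrib_left mult_ac)
qed

(* The excluded derivative enters the curvature only for i = j, where it cancels, so no
   differentiability of ibc2_coeff is needed. *)
lemma pd_lss_christoffel:
  fixes \<theta> :: "real^3"
  assumes "\<theta>$2 > 0" and "i \<noteq> 3 \<or> j \<noteq> 3 \<or> k \<noteq> 3"
  shows "pd i (\<lambda>\<theta>. lss_christoffel l j k (\<theta>$2) (\<theta>$3)) \<theta> =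
    (if i = 2 \<and> j = 3 \<and> k = 3 \<and> l \<noteq> 3 then ibc2_coeff l (\<theta>$3)
     else if i = 2 \<and> l = 3 \<and> (j = 2 \<and> k = 3 \<or> j = 3 \<and> k = 2) then - 1 / (\<theta>$2)\<^sup>2
     else 0)"
proof -
  consider "i = 1" | "i = 2" | "i = 3" using exhaust_3 by blast
  then show ?thesis
  proof cases
    case 1
    then show ?thesis by (simp add: pd_1_scale_shape)
  next
    case 2
    consider "j = 3 \<and> k = 3" | "l = 3 \<and> (j = 2 \<and> k = 3 \<or> j = 3 \<and> k = 2)"
      | "\<not> (j = 3 \<and> k = 3)" "\<not> (l = 3 \<and> (j = 2 \<and> k = 3 \<or> j = 3 \<and> k = 2))"
      by blast
    then show ?thesis
    proof cases
      case 1
      then have "((\<lambda>s. lss_christoffel l j k s (\<theta>$3)) has_real_derivative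
          (if l = 3 then 0 else ibc2_coeff l (\<theta>$3))) (at (\<theta>$2))"
        by (auto simp: lss_christoffel_def intro!: derivative_eq_intros)
      from pd_2_scale_shape[of "lss_christoffel l j k", OF this] 1 2 show ?thesis by simp
    next
      case 2
      then have "lss_christoffel l j k = (\<lambda>s _. 1 / s)"
        by (auto simp: lss_christoffel_def fun_eq_iff)
      moreover have "((\<lambda>s. 1 / s) has_real_derivative - 1 / (\<theta>$2)\<^sup>2) (at (\<theta>$2))"
        using assms(1) by (auto simp: power2_eq_square intro!: derivative_eq_intros)
      ultimately show ?thesis
        using pd_2_scale_shape[of "\<lambda>s _. 1 / s" \<theta>] 2 \<open>i = 2\<close> by auto
    next
      case 3
      then have "lss_christoffel l j k = (\<lambda>_ _. 0)"
        by (auto simp: lss_christoffel_def fun_eq_iff)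
      then show ?thesis
        using pd_2_scale_shape[of "\<lambda>_ _. 0" \<theta> 0] 3 2 by auto
    qed
  next
    case 3
    then have "\<not> (j = 3 \<and> k = 3)" using assms(2) by simp
    then have "lss_christoffel l j k (\<theta>$2)
        = (\<lambda>_. if l = 3 \<and> (j = 2 \<and> k = 3 \<or> j = 3 \<and> k = 2) then 1 / \<theta>$2 else 0)"
      by (auto simp: lss_christoffel_def fun_eq_iff)
    then have "(lss_christoffel l j k (\<theta>$2) has_real_derivative 0) (at (\<theta>$3))"
      by (simp only: DERIV_const)
    from pd_3_scale_shape[of "lss_christoffel l j k", OF this] 3 show ?thesis by simp
  qed
qed

lemma christoffel_gram_metric_pd:
  assumes "\<theta> \<in> lss_params \<Xi>"
  shows "pd i (christoffel gram_metric l j k) \<theta>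
    = pd i (\<lambda>\<theta>. lss_christoffel l j k (\<theta>$2) (\<theta>$3)) \<theta>"
  by (rule pd_cong[OF open_lss_params[OF open_shapes] assms christoffel_gram_metric])

text \<open>For distinct i, j only the pair 2, 3 gives nonzero terms. With k = 3 and l \<noteq> 3,
  the \<sigma>-derivative c_l of \<sigma> c_l cancels against (\<sigma> c_l) (1 / \<sigma>); with k
  = 2 and l = 3, the derivative of 1 / \<sigma> cancels against its square; with k = l = 3, the two
  products coincide.\<close>

lemma riemann_curvature_gram_metric:
  assumes "\<theta> \<in> lss_params \<Xi>"
  shows "riemann_curvature gram_metric l i j k \<theta> = 0"
proof (cases "i = j")
  case True
  then show ?thesis by (simp add: riemann_curvature_def)
next
  case False
  have pos: "\<theta>$2 > 0" using assms by (simp add: lss_params_def)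
  have ij: "i \<noteq> 3 \<or> j \<noteq> 3 \<or> k \<noteq> 3" "j \<noteq> 3 \<or> i \<noteq> 3 \<or> k \<noteq> 3" using False by auto
  show ?thesis
    using exhaust_3[of i] exhaust_3[of j] exhaust_3[of k] exhaust_3[of l] False pos
    unfolding riemann_curvature_def christoffel_gram_metric_pd[OF assms]
      pd_lss_christoffel[OF pos ij(1)] pd_lss_christoffel[OF pos ij(2)]
      christoffel_gram_metric[OF assms] sum_3
    by (elim disjE) (simp_all add: lss_christoffel_def power2_eq_square)
qed

end

section \<open>Transfer from the Gram metric to the Wasserstein metric\<close>

lemma riemann_curvature_cong:
  assumes "open U" "\<theta> \<in> U" "\<And>\<theta>. \<theta> \<in> U \<Longrightarrow> g \<theta> = h \<theta>"
  shows "riemann_curvature g l i j k \<theta> = riemann_curvature h l i j k \<theta>"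
proof -
  have "pd a (christoffel g b c d) \<theta> = pd a (christoffel h b c d) \<theta>" for a b c d
    by (rule pd_cong[OF assms(1,2) christoffel_cong[OF assms(1) _ assms(3)]])
  then show ?thesis
    by (simp only: riemann_curvature_def christoffel_cong[OF assms(1,2), of g h, OF assms(3)])
qed

lemma riemannian_metric_on_cong:
  assumes "open U" "\<And>\<theta>. \<theta> \<in> U \<Longrightarrow> g \<theta> = h \<theta>" "riemannian_metric_on U g"
  shows "riemannian_metric_on U h"
  unfolding riemannian_metric_on_def
proof (intro conjI allI)
  fix i j k
  have "Ck_on k (\<lambda>\<theta>. g \<theta> $ i $ j) U"
    using assms(3) by (simp add: riemannian_metric_on_def)
  then show "Ck_on k (\<lambda>\<theta>. h \<theta> $ i $ j) U"
    by (rule Ck_on_cong[OF assms(1), rotated]) (simp add: assms(2))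
next
  show "\<forall>\<theta>\<in>U. transpose (h \<theta>) = h \<theta> \<and> (\<forall>v. v \<noteq> 0 \<longrightarrow> v \<bullet> (h \<theta> *v v) > 0)"
    using assms(2,3) by (simp add: riemannian_metric_on_def)
qed

theorem theorem3:
  fixes f :: "real \<Rightarrow> real" and \<Xi> :: "real set" and \<Phi> :: "3 \<Rightarrow> real^3 \<Rightarrow> real \<Rightarrow> real"
  assumes "open \<Xi>" and "0 \<in> \<Xi>"
    and "Ck_real 4 f" and "prob_density f"
    and "\<forall>t \<in> (\<lambda>\<xi>. 2 * \<xi>) ` \<Xi>. mgf f t < \<infinity>"
    and "lss_scores f \<Xi> \<Phi>"
  defines "g\<^sub>W \<equiv> wasserstein_information (lss_density f) \<Phi>"
  shows "riemannian_metric_on (lss_params \<Xi>) g\<^sub>W \<and>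
    (\<forall>\<theta>\<in>lss_params \<Xi>. \<forall>l i j k. riemann_curvature g\<^sub>W l i j k \<theta> = 0)"
proof -
  have "(deriv ^^ 0) f differentiable_on UNIV"
    using assms(3) unfolding Ck_real_def by (meson zero_less_numeral)
  then have cont: "continuous_on UNIV f"
    by (simp add: differentiable_imp_continuous_on)
  interpret shape_generator f \<Xi>
    by unfold_locales (use cont assms(1,2,4,5) in \<open>simp_all add: prob_density_def\<close>)
  have eq: "gram_metric \<theta> = g\<^sub>W \<theta>" if "\<theta> \<in> lss_params \<Xi>" for \<theta>
    using wasserstein_information_eq[OF assms(6) that] by (simp only: g\<^sub>W_def)
  note op = open_lss_params[OF open_shapes]
  show ?thesis
  proof (intro conjI ballI allI)
    show "riemannian_metric_on (lss_params \<Xi>) g\<^sub>W"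
      by (rule riemannian_metric_on_cong[OF op eq gram_metric_riemannian])
    fix \<theta> l i j k assume \<theta>: "\<theta> \<in> lss_params \<Xi>"
    show "riemann_curvature g\<^sub>W l i j k \<theta> = 0"
      by (rule trans[OF riemann_curvature_cong[OF op \<theta> eq, symmetric]
            riemann_curvature_gram_metric[OF \<theta>]])
  qed
qed

end
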